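(* Let $\nu$ be a convergent length distribution function, normalized so that $\int_1^\infty\nu(\ell)\,d\ell=1$, and let $Z_\nu(L)=\int_0^L\nu(\ell)\,d\ell$. If $$\int_1^\infty\frac{1-Z_\nu(L)}{L}\,dL<\infty,$$ then in the $\nu$-RSA process there exists a constant $\alpha_\nu>0$ such that $\mathbb{E}[S_L]\sim\alpha_\nu L$ as $L\to\infty$, i.e. $\lim_{L\to\infty}\mathbb{E}[S_L]/(\alpha_\nu L)=1$.
   Context: A length distribution function (ldf) is a nonnegative function $\nu:[0,\infty)\to[0,\infty)$, integrable on bounded intervals, with $\nu(\ell)=0$ for $\ell\in[0,1)$ and $\int_1^\ell\nu(t)\,dt>0$ for all $\ell>1$. Its normalizing constant is $Z_\nu(L)=\int_0^L\nu(\ell)\,d\ell$. It is convergent if $\lim_{L\to\infty}Z_\nu(L)<\infty$, and divergent otherwise. $\nu$-RSA process on $[0,L]$ ($L>1$): start with $I_0=[0,L]$. At each time $T=1,2,\dots$, independently of the past, sample $b$ uniformly from $[0,L]$ and, independently, a length $\ell\in[1,L]$ with density $\nu(\ell)/Z_\nu(L)$. If $(b,b+\ell)\subseteq I_{T-1}$, the segment is parked and $I_T=I_{T-1}\setminus(b,b+\ell)$; otherwise $I_T=I_{T-1}$. The empty space at saturation is $S_L=\lim_{T\to\infty}\lambda(I_T)$, where $\lambda$ is Lebesgue measure. For $0\le L\le 1$ no segment is parked and $S_L=L$. *)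

theory Defs
  imports "HOL-Probability.Probability"
begin

definition ldf :: "(real \<Rightarrow> real) \<Rightarrow> bool" where
  "ldf \<nu> \<longleftrightarrow>
     (\<forall>l\<ge>0. \<nu> l \<ge> 0) \<and>
     (\<forall>a\<ge>0. \<forall>b. set_integrable lebesgue {a..b} \<nu>) \<and>
     (\<forall>l\<in>{0..<1}. \<nu> l = 0) \<and>
     (\<forall>l>1. (LINT t:{1..l}|lebesgue. \<nu> t) > 0)"

definition norm_const :: "(real \<Rightarrow> real) \<Rightarrow> real \<Rightarrow> real" where
  "norm_const \<nu> L = (LINT l:{0..L}|lebesgue. \<nu> l)"

definition convergent_ldf :: "(real \<Rightarrow> real) \<Rightarrow> bool" where
  "convergent_ldf \<nu> \<longleftrightarrow> ldf \<nu> \<and> (\<exists>c. (norm_const \<nu> \<longlongrightarrow> c) at_top)"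

definition length_law :: "(real \<Rightarrow> real) \<Rightarrow> real \<Rightarrow> real measure" where
  "length_law \<nu> L =
     density lebesgue (\<lambda>l. ennreal (\<nu> l / norm_const \<nu> L) * indicator {1..L} l)"

definition segment_law :: "(real \<Rightarrow> real) \<Rightarrow> real \<Rightarrow> (real \<times> real) measure" where
  "segment_law \<nu> L = uniform_measure lborel {0..L} \<Otimes>\<^sub>M length_law \<nu> L"

(* A point of the sample space is the sequence of i.i.d. proposals (b, l);
   the proposal made at time T + 1 has index T. *)
definition rsa_space :: "(real \<Rightarrow> real) \<Rightarrow> real \<Rightarrow> (real \<times> real) stream measure" where
  "rsa_space \<nu> L = stream_space (segment_law \<nu> L)"

definition park :: "real set \<Rightarrow> real \<times> real \<Rightarrow> real set" where
  "park I = (\<lambda>(b, l). if {b<..<b + l} \<subseteq> I then I - {b<..<b + l} else I)"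

primrec unoccupied :: "real set \<Rightarrow> (real \<times> real) stream \<Rightarrow> nat \<Rightarrow> real set" where
  "unoccupied I \<omega> 0 = I"
| "unoccupied I \<omega> (Suc T) = park (unoccupied I \<omega> T) (\<omega> !! T)"

definition empty_space :: "real \<Rightarrow> (real \<times> real) stream \<Rightarrow> real" where
  "empty_space L \<omega> = lim (\<lambda>T. measure lborel (unoccupied {0..L} \<omega> T))"

(* For L <= 1 the normalizing constant vanishes and there is no length distribution to sample
   from; by convention nothing is parked and the saturated empty space is deterministically L. *)
definition expected_empty_space :: "(real \<Rightarrow> real) \<Rightarrow> real \<Rightarrow> real" where
  "expected_empty_space \<nu> L =
     (if L \<le> 1 then L else integral\<^sup>L (rsa_space \<nu> L) (empty_space L))"

lemma norm_const_eq:
  assumes "ldf \<nu>"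
  shows "norm_const \<nu> L = (LINT l:{1..L}|lebesgue. \<nu> l)"
proof -
  have "indicator {0..L} l *\<^sub>R \<nu> l = indicator {1..L} l *\<^sub>R \<nu> l" for l
    using assms by (auto simp: ldf_def indicator_def)
  then show ?thesis
    by (simp only: norm_const_def set_lebesgue_integral_def)
qed

lemma prob_space_length_law:
  assumes "ldf \<nu>" "L > 1"
  shows "prob_space (length_law \<nu> L)"
proof -
  have pos: "norm_const \<nu> L > 0"
    using assms by (simp add: norm_const_eq) (simp add: ldf_def)
  have int: "integrable lebesgue (\<lambda>l. indicator {1..L} l *\<^sub>R \<nu> l)"
    using assms unfolding ldf_def set_integrable_def by auto
  have nn: "indicator {1..L} l *\<^sub>R \<nu> l \<ge> 0" for l
    using assms by (auto simp: ldf_def indicator_def)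
  have eq: "ennreal (\<nu> l / norm_const \<nu> L) * indicator {1..L} l
      = ennreal (indicator {1..L} l *\<^sub>R \<nu> l / norm_const \<nu> L)" for l
    by (auto simp: indicator_def)
  have "(\<integral>\<^sup>+l. ennreal (indicator {1..L} l *\<^sub>R \<nu> l / norm_const \<nu> L) \<partial>lebesgue)
      = ennreal (LINT l|lebesgue. indicator {1..L} l *\<^sub>R \<nu> l / norm_const \<nu> L)"
    by (rule nn_integral_eq_integral)
      (use int nn pos in \<open>auto intro!: divide_nonneg_pos\<close>)
  also have "(LINT l|lebesgue. indicator {1..L} l *\<^sub>R \<nu> l / norm_const \<nu> L) = 1"
    using pos norm_const_eq[OF assms(1), of L]
    by (simp add: set_lebesgue_integral_def)
  finally have 1: "(\<integral>\<^sup>+l. ennreal (indicator {1..L} l *\<^sub>R \<nu> l / norm_const \<nu> L) \<partial>lebesgue) = 1"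
    by simp
  have [measurable]: "(\<lambda>l. indicator {1..L} l *\<^sub>R \<nu> l) \<in> borel_measurable lebesgue"
    using int by (rule borel_measurable_integrable)
  show ?thesis
    unfolding length_law_def eq
    by (rule prob_spaceI) (use 1 in \<open>simp add: emeasure_density del: real_scaleR_def\<close>)
qed

lemma prob_space_rsa_space:
  assumes "ldf \<nu>" "L > 1"
  shows "prob_space (rsa_space \<nu> L)"
proof -
  interpret U: prob_space "uniform_measure lborel {0..L}"
    by (rule prob_space_uniform_measure) (use assms in auto)
  interpret K: prob_space "length_law \<nu> L"
    by (rule prob_space_length_law[OF assms])
  interpret UK: pair_prob_space "uniform_measure lborel {0..L}" "length_law \<nu> L" ..
  show ?thesis
    unfolding rsa_space_def segment_law_def
    by (rule prob_space.prob_space_stream_space) (rule UK.prob_space_axioms)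
qed

lemma unoccupied_bounds:
  "unoccupied {0..L} \<omega> T \<in> sets borel \<and> unoccupied {0..L} \<omega> T \<subseteq> {0..L}"
  by (induction T) (auto simp: park_def split: prod.splits)

lemma empty_space_LIMSEQ:
  "(\<lambda>T. measure lborel (unoccupied {0..L} \<omega> T)) \<longlonglongrightarrow> empty_space L \<omega>"
proof -
  have fm: "unoccupied {0..L} \<omega> T \<in> fmeasurable lborel" for T
    by (rule fmeasurableI2[of "{0..L}"]) (use unoccupied_bounds in \<open>auto simp: fmeasurable_def emeasure_lborel_Icc_eq\<close>)
  have "decseq (\<lambda>T. measure lborel (unoccupied {0..L} \<omega> T))"
  proof (rule decseq_SucI)
    fix T
    have "unoccupied {0..L} \<omega> (Suc T) \<subseteq> unoccupied {0..L} \<omega> T"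
      by (auto simp: park_def split: prod.splits if_splits)
    then show "measure lborel (unoccupied {0..L} \<omega> (Suc T)) \<le> measure lborel (unoccupied {0..L} \<omega> T)"
      by (rule measure_mono_fmeasurable) (use fm unoccupied_bounds in \<open>auto simp del: unoccupied.simps\<close>)
  qed
  then have "convergent (\<lambda>T. measure lborel (unoccupied {0..L} \<omega> T))"
    by (metis decseq_convergent measure_nonneg convergentI)
  then show ?thesis
    by (simp add: empty_space_def convergent_LIMSEQ_iff)
qed

end

theory Submission
  imports Defs
begin

text \<open>
  Write \<open>S\<close> for the expected empty space, \<open>Z\<close> for the normalizing constant, \<open>R = 1 - Z\<close>,
  \<open>M x = \<integral>\<^sub>0\<^sup>x R\<close> and \<open>F x = \<integral>\<^sub>0\<^sup>x S\<close>. Conditioning on the first parked segment, which splits the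
  interval into two gaps that are filled in the same way, yields for \<open>x > 1\<close>
  \<open>S x * \<integral>\<^sub>0\<^sup>x Z = 2 * \<integral>\<^sub>0\<^sup>x S t * Z (x - t) dt\<close>, that is, \<open>x * S x = 2 * F x - 2 * E x + S x * M x\<close>
  with \<open>E x = \<integral>\<^sub>0\<^sup>x S t * R (x - t) dt\<close>. So \<open>F x / x\<^sup>2\<close> has derivative \<open>(S x * M x - 2 * E x) / x ^ 3\<close>,
  whose absolute value is at most \<open>2 * M x / x\<^sup>2\<close>; this is integrable precisely because
  \<open>R x / x\<close> is. Hence \<open>F x / x\<^sup>2\<close> converges, and \<open>S x / x\<close> converges to twice its limit. The limit
  is positive by a Gronwall argument, in which \<open>E\<close> is controlled through its primitive.
\<close>

subsection \<open>Empty space left in a union of gaps\<close>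

text \<open>\<open>unoccupied\<close> recurses on the last step; conditioning on the first proposal
  needs the first step peeled off instead.\<close>

lemma unoccupied_Stream: "unoccupied I (p ## \<omega>) (Suc T) = unoccupied (park I p) \<omega> T"
  by (induction T) auto

lemma compact_unoccupied: "compact I \<Longrightarrow> compact (unoccupied I \<omega> T)"
  by (induction T) (auto simp: park_def compact_diff split: prod.splits)

lemma unoccupied_Suc_subset: "unoccupied I \<omega> (Suc T) \<subseteq> unoccupied I \<omega> T"
  by (auto simp: park_def split: prod.splits if_splits)

lemma unoccupied_subset: "unoccupied I \<omega> T \<subseteq> I"
proof (induction T)
  case (Suc T)
  then show ?case using unoccupied_Suc_subset[of I \<omega> T] by (rule subset_trans[rotated])
qed simp

text \<open>The starting set is arbitrary, since one parked segment turns an interval into two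
  gaps.\<close>

definition empty_limit :: "real set \<Rightarrow> (real \<times> real) stream \<Rightarrow> real" where
  "empty_limit I \<omega> = lim (\<lambda>T. measure lborel (unoccupied I \<omega> T))"

lemma empty_space_eq: "empty_space L = empty_limit {0..L}"
  by (simp add: empty_space_def empty_limit_def fun_eq_iff)

lemma empty_limit_LIMSEQ:
  assumes "compact I"
  shows "(\<lambda>T. measure lborel (unoccupied I \<omega> T)) \<longlonglongrightarrow> empty_limit I \<omega>"
proof -
  have "decseq (\<lambda>T. measure lborel (unoccupied I \<omega> T))"
    using assms compact_unoccupied fmeasurable_compact unoccupied_Suc_subset
    by (intro decseq_SucI measure_mono_fmeasurable) (auto simp del: unoccupied.simps intro!: borel_compact)
  then have "convergent (\<lambda>T. measure lborel (unoccupied I \<omega> T))"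
    by (metis decseq_convergent measure_nonneg convergentI)
  then show ?thesis
    by (simp add: empty_limit_def convergent_LIMSEQ_iff)
qed

lemma empty_limit_nonneg: "compact I \<Longrightarrow> 0 \<le> empty_limit I \<omega>"
  by (rule LIMSEQ_le_const[OF empty_limit_LIMSEQ]) auto

lemma empty_limit_le: 
  assumes "compact I" shows "empty_limit I \<omega> \<le> measure lborel I"
proof (rule LIMSEQ_le_const2[OF empty_limit_LIMSEQ[OF assms]])
  have "measure lborel (unoccupied I \<omega> T) \<le> measure lborel I" for T
    using assms compact_unoccupied fmeasurable_compact
    by (intro measure_mono_fmeasurable unoccupied_subset) (auto intro!: borel_compact)
  then show "\<exists>N. \<forall>n\<ge>N. measure lborel (unoccupied I \<omega> n) \<le> measure lborel I" by blast
qed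

lemma compact_park: "compact I \<Longrightarrow> compact (park I p)"
  by (auto simp: park_def compact_diff split: prod.splits)

lemma empty_limit_Stream:
  assumes "compact I"
  shows "empty_limit I (p ## \<omega>) = empty_limit (park I p) \<omega>"
  by (rule LIMSEQ_unique[OF LIMSEQ_Suc[OF empty_limit_LIMSEQ[OF assms]]])
     (use empty_limit_LIMSEQ[OF compact_park[OF assms]] in \<open>simp add: unoccupied_Stream del: unoccupied.simps\<close>)

section \<open>Additivity over separated gaps\<close>

lemma park_separated_Un:
  assumes "I \<subseteq> {..c}" "J \<subseteq> {d..}" "c < d"
  shows "park (I \<union> J) p = park I p \<union> park J p"
proof -
  obtain b l where p: "p = (b, l)" by fastforce
  define X where "X = {b<..<b+l}"
  have pk: "park K p = (if X \<subseteq> K then K - X else K)" for K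
    by (simp add: p park_def X_def)
  show ?thesis
  proof (cases "X = {}")
    case False
    \<comment> \<open>An interval inside the union cannot meet both parts: it would contain the
      midpoint of \<open>c\<close> and \<open>d\<close>, which lies in neither. Touching parts would
      allow this, hence the strict \<open>c < d\<close>.\<close>
    have *: "X \<subseteq> I \<or> X \<subseteq> J" if X: "X \<subseteq> I \<union> J"
    proof (rule ccontr)
      assume "\<not> (X \<subseteq> I \<or> X \<subseteq> J)"
      then obtain u v where uv: "u \<in> X" "v \<in> X" "u \<in> I" "v \<in> J"
        using X by blast
      then have "u \<le> c" "d \<le> v" using assms(1,2) by auto
      then have "(c + d) / 2 \<in> X" using uv(1,2) assms(3) by (simp add: X_def)
      then have "(c + d) / 2 \<le> c \<or> d \<le> (c + d) / 2" using X assms(1,2) by blast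
      then show False using assms(3) by (simp add: field_simps)
    qed
    have "I \<inter> J = {}" using assms by fastforce
    then have "X \<subseteq> I \<Longrightarrow> J - X = J \<and> \<not> X \<subseteq> J" "X \<subseteq> J \<Longrightarrow> I - X = I \<and> \<not> X \<subseteq> I"
      using False by blast+
    then show ?thesis using * unfolding pk by auto
  qed (simp add: pk)
qed

lemma unoccupied_separated_Un:
  assumes "I \<subseteq> {..c}" "J \<subseteq> {d..}" "c < d"
  shows "unoccupied (I \<union> J) \<omega> T = unoccupied I \<omega> T \<union> unoccupied J \<omega> T"
proof (induction T)
  case (Suc T)
  have "unoccupied I \<omega> T \<subseteq> {..c}" "unoccupied J \<omega> T \<subseteq> {d..}"
    using assms unoccupied_subset by blast+
  from park_separated_Un[OF this assms(3)] Suc show ?case by simp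
qed simp

text \<open>The same proposals drive both gaps, so the lengths add for every
  \<open>\<omega>\<close>, and expectations will add without any independence between the
  gaps.\<close>

lemma empty_limit_separated_Un:
  assumes "compact I" "compact J" "I \<subseteq> {..c}" "J \<subseteq> {d..}" "c < d"
  shows "empty_limit (I \<union> J) \<omega> = empty_limit I \<omega> + empty_limit J \<omega>"
proof -
  have "measure lborel (unoccupied (I \<union> J) \<omega> T) =
      measure lborel (unoccupied I \<omega> T) + measure lborel (unoccupied J \<omega> T)" for T
  proof -
    have "unoccupied I \<omega> T \<inter> unoccupied J \<omega> T = {}"
      using unoccupied_subset[of I \<omega> T] unoccupied_subset[of J \<omega> T] assms(3-5) by fastforce
    then show ?thesis
      unfolding unoccupied_separated_Un[OF assms(3-5)]
      by (intro measure_Un_AE fmeasurable_compact compact_unoccupied assms) auto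
  qed
  then have "(\<lambda>T. measure lborel (unoccupied (I \<union> J) \<omega> T)) \<longlonglongrightarrow> empty_limit I \<omega> + empty_limit J \<omega>"
    using tendsto_add[OF empty_limit_LIMSEQ[OF assms(1)] empty_limit_LIMSEQ[OF assms(2)]] by simp
  moreover have "compact (I \<union> J)" using assms by (simp add: compact_Un)
  ultimately show ?thesis using empty_limit_LIMSEQ LIMSEQ_unique by blast
qed

section \<open>Measurability of the empty space\<close>

lemma greaterThanLessThan_subset_iff_rational:
  assumes "closed (K :: real set)"
  shows "{b<..<c} \<subseteq> K \<longleftrightarrow> (\<forall>q\<in>\<rat>. b < q \<and> q < c \<longrightarrow> q \<in> K)"
proof
  assume *: "\<forall>q\<in>\<rat>. b < q \<and> q < c \<longrightarrow> q \<in> K"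
  show "{b<..<c} \<subseteq> K"
  proof (rule ccontr)
    assume "\<not> {b<..<c} \<subseteq> K"
    then obtain x where "x \<in> {b<..<c}" "x \<notin> K" by (meson subsetI)
    then have x: "x \<in> {b<..<c} \<inter> - K" by simp
    have "open ({b<..<c} \<inter> - K)" using assms by (intro open_Int) (auto simp: open_Compl)
    from this x obtain e where e: "e > 0" "ball x e \<subseteq> {b<..<c} \<inter> - K" using open_contains_ball by metis
    \<comment> \<open>A whole ball around the missing point avoids \<open>K\<close>, so a rational
      of the interval is missing too.\<close>
    obtain q where "q \<in> \<rat>" "x < q" "q < x + e" using Rats_dense_in_real[of x "x + e"] e by auto
    then have "q \<in> ball x e" by (auto simp: dist_real_def)
    then have "q \<in> {b<..<c}" "q \<notin> K" using e(2) by blast+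
    then show False using * \<open>q \<in> \<rat>\<close> by auto
  qed
qed auto

text \<open>Unoccupied sets are closed, so whether a proposal is accepted can be tested on the rationals;
  this makes acceptance a countable combination of events of the form \<open>q \<in> unoccupied I \<omega> T\<close>.\<close>

lemma measurable_unoccupied:
  assumes [measurable]: "fst \<in> borel_measurable M" "snd \<in> borel_measurable M"
    and "compact I"
  shows "Measurable.pred (stream_space M) (\<lambda>\<omega>. x \<in> unoccupied I \<omega> T)"
    and "(\<lambda>\<omega>. measure lborel (unoccupied I \<omega> T)) \<in> borel_measurable (stream_space M)"
proof -
  have [measurable]: "(\<lambda>\<omega>. fst (\<omega> !! T)) \<in> borel_measurable (stream_space M)"
     "(\<lambda>\<omega>. snd (\<omega> !! T)) \<in> borel_measurable (stream_space M)" for T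
    using measurable_compose[OF measurable_snth assms(1)] measurable_compose[OF measurable_snth assms(2)] by auto
  define acc where "acc T \<omega> \<longleftrightarrow> {fst (\<omega> !! T)<..<fst (\<omega> !! T) + snd (\<omega> !! T)} \<subseteq> unoccupied I \<omega> T" for T \<omega>
  have acc: "acc T \<omega> \<longleftrightarrow> (\<forall>q\<in>\<rat>. fst (\<omega> !! T) < q \<and> q < fst (\<omega> !! T) + snd (\<omega> !! T) \<longrightarrow> q \<in> unoccupied I \<omega> T)"
    for T \<omega> unfolding acc_def
    by (rule greaterThanLessThan_subset_iff_rational) (use assms compact_unoccupied compact_imp_closed in blast)
  have step: "unoccupied I \<omega> (Suc T) = (if acc T \<omega> then unoccupied I \<omega> T - {fst (\<omega> !! T)<..<fst (\<omega> !! T) + snd (\<omega> !! T)} else unoccupied I \<omega> T)" for T \<omega>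
    by (auto simp: acc_def park_def split: prod.splits)
  have *: "Measurable.pred (stream_space M) (\<lambda>\<omega>. x \<in> unoccupied I \<omega> T)" for T x
  proof (induction T arbitrary: x)
    case (Suc T)
    note Suc.IH[measurable]
    have [measurable]: "Measurable.pred (stream_space M) (acc T)"
      unfolding acc using countable_rat by measurable
    have "(x \<in> unoccupied I \<omega> (Suc T)) = (x \<in> unoccupied I \<omega> T \<and> \<not> (acc T \<omega> \<and> fst (\<omega> !! T) < x \<and> x < fst (\<omega> !! T) + snd (\<omega> !! T)))"
      for \<omega> unfolding step by auto
    then show ?case by simp
  qed simp
  then show "Measurable.pred (stream_space M) (\<lambda>\<omega>. x \<in> unoccupied I \<omega> T)" .
  have [measurable]: "Measurable.pred (stream_space M) (acc T)" for T
    unfolding acc using countable_rat * by measurable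
  show "(\<lambda>\<omega>. measure lborel (unoccupied I \<omega> T)) \<in> borel_measurable (stream_space M)"
  proof (induction T)
    case (Suc T)
    note Suc.IH[measurable]
    \<comment> \<open>\<open>max 0\<close> accounts for nonpositive proposed lengths, whose segment
      is empty; \<open>M\<close> is still an arbitrary measure here.\<close>
    have "measure lborel (unoccupied I \<omega> (Suc T)) =
       measure lborel (unoccupied I \<omega> T) - (if acc T \<omega> then max 0 (snd (\<omega> !! T)) else 0)" for \<omega>
    proof (cases "acc T \<omega>")
      case True
      have "measure lborel (unoccupied I \<omega> T - {fst (\<omega> !! T)<..<fst (\<omega> !! T) + snd (\<omega> !! T)}) =
         measure lborel (unoccupied I \<omega> T) - measure lborel {fst (\<omega> !! T)<..<fst (\<omega> !! T) + snd (\<omega> !! T)}"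
        using True compact_unoccupied[OF assms(3)] 
        by (intro measure_Diff) (auto simp: acc_def fmeasurable_compact fmeasurableD2 borel_compact)
      then show ?thesis using True unfolding step by (simp add: max_def)
    next
      case False then show ?thesis unfolding step by simp
    qed
    then show ?case by simp
  qed simp
qed

lemma borel_measurable_empty_limit:
  assumes "fst \<in> borel_measurable M" "snd \<in> borel_measurable M" "compact I"
  shows "empty_limit I \<in> borel_measurable (stream_space M)"
  by (rule borel_measurable_LIMSEQ_real[OF empty_limit_LIMSEQ[OF assms(3)] measurable_unoccupied(2)[OF assms]])

subsection \<open>The law of a proposal\<close>

lemma norm_const_mono:
  assumes "ldf \<nu>" shows "mono (norm_const \<nu>)"
proof (rule monoI)
  fix x y :: real assume "x \<le> y"
  have int: "integrable lebesgue (\<lambda>l. indicator {0..c} l *\<^sub>R \<nu> l)" for c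
    using assms unfolding ldf_def set_integrable_def by auto
  have nn: "\<nu> l \<ge> 0" if "l \<ge> 0" for l using assms that by (auto simp: ldf_def)
  show "norm_const \<nu> x \<le> norm_const \<nu> y"
    unfolding norm_const_def set_lebesgue_integral_def
    using \<open>x \<le> y\<close> nn by (intro integral_mono int) (auto simp: indicator_def)
qed

lemma norm_const_eq_0:
  assumes "ldf \<nu>" "x \<le> 1" shows "norm_const \<nu> x = 0"
proof -
  \<comment> \<open>\<open>\<nu> 1\<close> may be nonzero, so the case \<open>x = 1\<close> rests on
    a single point being null.\<close>
  have "AE l in lebesgue. l \<noteq> (1::real)"
    by (intro AE_not_in[of "{1}", simplified]) simp
  then have "(LINT l|lebesgue. indicator {1..x} l *\<^sub>R \<nu> l) = 0"
    using assms(2) by (intro integral_eq_zero_AE) (auto elim!: eventually_mono simp: indicator_def)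
  then show ?thesis
    by (simp add: norm_const_eq[OF assms(1)] set_lebesgue_integral_def)
qed

lemma norm_const_pos:
  assumes "ldf \<nu>" "x > 1" shows "norm_const \<nu> x > 0"
  using assms norm_const_eq[OF assms(1)] unfolding ldf_def by simp

lemma norm_const_nonneg: "ldf \<nu> \<Longrightarrow> norm_const \<nu> x \<ge> 0"
  using norm_const_pos[of \<nu> x] norm_const_eq_0[of \<nu> x] by fastforce

lemma borel_measurable_norm_const [measurable]:
  "ldf \<nu> \<Longrightarrow> norm_const \<nu> \<in> borel_measurable borel"
  by (intro borel_measurable_mono norm_const_mono)

text \<open>The convolution of \<open>g\<close> with the normalizing constant. Here \<open>t\<close>
  is the gap to the left of a segment accepted in an interval of length \<open>x\<close>: positions
  are uniform, and the length fits with probability proportional to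
  \<open>norm_const \<nu> (x - t)\<close>. Extended values spare integrability conditions.\<close>

definition gap_integral :: "(real \<Rightarrow> real) \<Rightarrow> (real \<Rightarrow> ennreal) \<Rightarrow> real \<Rightarrow> ennreal" where
  "gap_integral \<nu> g x = (\<integral>\<^sup>+t. g t * ennreal (norm_const \<nu> (x - t)) * indicator {0..x} t \<partial>lborel)"

lemma borel_measurable_gap_integral [measurable]:
  assumes ldf: "ldf \<nu>" and [measurable]: "g \<in> borel_measurable borel"
  shows "gap_integral \<nu> g \<in> borel_measurable borel"
proof -
  note borel_measurable_norm_const[OF ldf, measurable]
  have "gap_integral \<nu> g = (\<lambda>x. \<integral>\<^sup>+t. (if 0 \<le> t \<and> t \<le> x then g t * ennreal (norm_const \<nu> (x - t)) else 0) \<partial>lborel)"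
    unfolding gap_integral_def by (auto intro!: ext nn_integral_cong simp: indicator_def)
  then show ?thesis by simp
qed

lemma gap_integral_1_pos:
  assumes "ldf \<nu>" "x > 1"
  shows "gap_integral \<nu> (\<lambda>_. 1) x > 0"
proof -
  \<comment> \<open>For \<open>t \<le> (x - 1) / 2\<close> the argument \<open>x - t\<close> is at
    least \<open>(x + 1) / 2 > 1\<close>, where the normalizing constant is positive.\<close>
  have "0 < ennreal (norm_const \<nu> ((x + 1) / 2)) * ennreal ((x - 1) / 2)"
    using assms norm_const_pos[of \<nu> "(x + 1) / 2"] by (simp add: ennreal_zero_less_mult_iff)
  also have "\<dots> = (\<integral>\<^sup>+t. ennreal (norm_const \<nu> ((x + 1) / 2)) * indicator {0..(x - 1) / 2} t \<partial>lborel)"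
    using assms(2) by (simp add: nn_integral_cmult_indicator)
  also have "\<dots> \<le> gap_integral \<nu> (\<lambda>_. 1) x"
    unfolding gap_integral_def
    using monoD[OF norm_const_mono[OF assms(1)]] assms(2)
    by (intro nn_integral_mono) (auto simp: indicator_def field_simps intro!: ennreal_leI)
  finally show ?thesis .
qed

lemma gap_integral_1_finite:
  assumes "ldf \<nu>"
  shows "gap_integral \<nu> (\<lambda>_. 1) x < \<infinity>"
proof -
  have "gap_integral \<nu> (\<lambda>_. 1) x \<le> (\<integral>\<^sup>+t. ennreal (norm_const \<nu> x) * indicator {0..x} t \<partial>lborel)"
    unfolding gap_integral_def using monoD[OF norm_const_mono[OF assms(1)]]
    by (intro nn_integral_mono) (auto simp: indicator_def intro!: ennreal_leI)
  also have "\<dots> < \<infinity>"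
    by (cases "0 \<le> x") (simp_all add: nn_integral_cmult_indicator ennreal_mult_less_top)
  finally show ?thesis .
qed

section \<open>One proposal on an interval of fixed length \<open>L\<close>\<close>

locale rsa_process =
  fixes \<nu> :: "real \<Rightarrow> real" and L :: real
  assumes ldf: "ldf \<nu>" and L: "L > 1"
begin

sublocale Len: prob_space "length_law \<nu> L"
  by (rule prob_space_length_law[OF ldf L])

sublocale Pos: prob_space "uniform_measure lborel {0..L}"
  by (rule prob_space_uniform_measure) (use L in auto)

sublocale Seg: pair_prob_space "uniform_measure lborel {0..L}" "length_law \<nu> L" ..

lemma prob_space_segment_law: "prob_space (segment_law \<nu> L)"
  unfolding segment_law_def by (rule Seg.prob_space_axioms)

lemma sets_length_law [measurable_cong]: "sets (length_law \<nu> L) = sets lebesgue"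
  by (simp add: length_law_def)

text \<open>The law lives on the Lebesgue sets because \<open>\<nu>\<close> need only be Lebesgue
  measurable; Borel functions of the length are reached through this identity map.\<close>

lemma measurable_length_law_borel: "(\<lambda>x. x) \<in> length_law \<nu> L \<rightarrow>\<^sub>M borel"
  unfolding measurable_cong_sets[OF sets_length_law refl] by (simp add: measurable_completion)

lemma measurable_snd_length_law [measurable]: "snd \<in> borel_measurable (N \<Otimes>\<^sub>M length_law \<nu> L)"
  by (rule measurable_compose[OF measurable_snd measurable_length_law_borel])

lemma measurable_fst_segment_law [measurable]: "fst \<in> borel_measurable (segment_law \<nu> L)"
  unfolding segment_law_def by measurable

lemma measurable_snd_segment_law [measurable]: "snd \<in> borel_measurable (segment_law \<nu> L)"
  unfolding segment_law_def by measurable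

lemma borel_measurable_norm_const' [measurable]: "norm_const \<nu> \<in> borel_measurable borel"
  by (rule borel_measurable_norm_const[OF ldf])

lemma length_density_eq:
  "ennreal (\<nu> l / norm_const \<nu> L) * indicator {1..L} l
    = ennreal (indicator {1..L} l *\<^sub>R \<nu> l / norm_const \<nu> L)"
  by (auto simp: indicator_def)

lemma length_density_measurable:
  "(\<lambda>l. ennreal (\<nu> l / norm_const \<nu> L) * indicator {1..L} l) \<in> borel_measurable lebesgue"
proof -
  have "set_integrable lebesgue {1..L} \<nu>"
    using ldf by (auto simp: ldf_def)
  then have [measurable]: "(\<lambda>l. indicator {1..L} l *\<^sub>R \<nu> l) \<in> borel_measurable lebesgue"
    unfolding set_integrable_def by (rule borel_measurable_integrable)
  show ?thesis
    unfolding length_density_eq by measurable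
qed

text \<open>The strict inequality, again due to the point 1 being null, ensures that not even a gap
  of length exactly 1 is filled.\<close>

lemma AE_length_law: "AE l in length_law \<nu> L. 1 < l"
proof -
  have "AE l in lebesgue. l \<noteq> (1::real)"
    by (intro AE_not_in[of "{1}", simplified]) simp
  then have "AE l in lebesgue. 0 < ennreal (\<nu> l / norm_const \<nu> L) * indicator {1..L} l \<longrightarrow> 1 < l"
    by eventually_elim (auto simp: indicator_def)
  then show ?thesis
    unfolding length_law_def 
    by (subst AE_density[OF length_density_measurable])
qed


lemma emeasure_length_law:
  assumes "y \<le> L"
  shows "emeasure (length_law \<nu> L) {..y} = ennreal (norm_const \<nu> y / norm_const \<nu> L)"
proof -
  have int: "integrable lebesgue (\<lambda>l. indicator {1..y} l *\<^sub>R \<nu> l)"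
    using ldf unfolding ldf_def set_integrable_def by auto
  have pos: "norm_const \<nu> L > 0" by (rule norm_const_pos[OF ldf L])
  have "emeasure (length_law \<nu> L) {..y} =
     (\<integral>\<^sup>+l. ennreal (indicator {1..L} l *\<^sub>R \<nu> l / norm_const \<nu> L) * indicator {..y} l \<partial>lebesgue)"
    unfolding length_law_def length_density_eq[symmetric] by (rule emeasure_density[OF length_density_measurable]) simp
  also have "\<dots> = (\<integral>\<^sup>+l. ennreal (indicator {1..y} l *\<^sub>R \<nu> l / norm_const \<nu> L) \<partial>lebesgue)"
    using assms by (intro nn_integral_cong) (auto simp: indicator_def)
  also have "\<dots> = ennreal (LINT l|lebesgue. indicator {1..y} l *\<^sub>R \<nu> l / norm_const \<nu> L)"
    by (rule nn_integral_eq_integral)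
       (use int pos ldf in \<open>auto simp: ldf_def indicator_def\<close>)
  also have "(LINT l|lebesgue. indicator {1..y} l *\<^sub>R \<nu> l / norm_const \<nu> L) = norm_const \<nu> y / norm_const \<nu> L"
    by (simp add: norm_const_eq[OF ldf] set_lebesgue_integral_def)
  finally show ?thesis .
qed

lemma nn_integral_uniform:
  assumes [measurable]: "f \<in> borel_measurable borel"
  shows "(\<integral>\<^sup>+b. f b \<partial>uniform_measure lborel {0..L}) = (\<integral>\<^sup>+b. f b * indicator {0..L} b \<partial>lborel) / ennreal L"
  using L by (subst nn_integral_uniform_measure) auto

lemma AE_segment_law: "AE p in segment_law \<nu> L. 1 < snd p"
  unfolding segment_law_def
proof (rule Seg.AE_pair_measure)
  show "{p \<in> space (uniform_measure lborel {0..L} \<Otimes>\<^sub>M length_law \<nu> L). 1 < snd p}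
      \<in> sets (uniform_measure lborel {0..L} \<Otimes>\<^sub>M length_law \<nu> L)"
    unfolding pred_def[symmetric] by measurable
qed (use AE_length_law in simp)

text \<open>The length is integrated out first: at a position \<open>b \<ge> a\<close> the segment
  fits with probability \<open>norm_const \<nu> (a + x - b) / norm_const \<nu> L\<close>. Shifting
  by \<open>a\<close> then removes the location of the gap.\<close>

lemma nn_integral_left_gap:
  assumes [measurable]: "g \<in> borel_measurable borel" and a: "0 \<le> a" "0 \<le> x" "a + x \<le> L"
  shows "(\<integral>\<^sup>+p. (if a \<le> fst p \<and> fst p + snd p \<le> a + x then g (fst p - a) else 0) \<partial>segment_law \<nu> L)
    = gap_integral \<nu> g x / (ennreal (norm_const \<nu> L) * ennreal L)"
proof -
  let ?Z = "norm_const \<nu>"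
  have pos: "?Z L > 0" by (rule norm_const_pos[OF ldf L])
  have inner: "(\<integral>\<^sup>+l. (if a \<le> b \<and> b + l \<le> a + x then g (b - a) else 0) \<partial>length_law \<nu> L)
      = g (b - a) * ennreal (?Z (a + x - b) / ?Z L) * indicator {a..} b" for b
  proof (cases "a \<le> b")
    case True
    have "(\<integral>\<^sup>+l. (if a \<le> b \<and> b + l \<le> a + x then g (b - a) else 0) \<partial>length_law \<nu> L)
       = (\<integral>\<^sup>+l. g (b - a) * indicator {..a + x - b} l \<partial>length_law \<nu> L)"
      using True by (intro nn_integral_cong) (auto simp: indicator_def)
    also have "\<dots> = g (b - a) * emeasure (length_law \<nu> L) {..a + x - b}"
      by (rule nn_integral_cmult_indicator) (simp add: sets_length_law)
    finally show ?thesis using True a by (simp add: emeasure_length_law)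
  qed simp
  have "(\<integral>\<^sup>+p. (if a \<le> fst p \<and> fst p + snd p \<le> a + x then g (fst p - a) else 0) \<partial>segment_law \<nu> L)
    = (\<integral>\<^sup>+b. \<integral>\<^sup>+l. (if a \<le> b \<and> b + l \<le> a + x then g (b - a) else 0) \<partial>length_law \<nu> L \<partial>uniform_measure lborel {0..L})"
    unfolding segment_law_def by (subst Len.nn_integral_fst[symmetric]) (simp_all cong: if_cong)
  also have "\<dots> = (\<integral>\<^sup>+b. g (b - a) * ennreal (?Z (a + x - b) / ?Z L) * indicator {a..} b * indicator {0..L} b \<partial>lborel) / ennreal L"
    unfolding inner by (rule nn_integral_uniform) measurable
  also have "(\<integral>\<^sup>+b. g (b - a) * ennreal (?Z (a + x - b) / ?Z L) * indicator {a..} b * indicator {0..L} b \<partial>lborel)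
     = (\<integral>\<^sup>+t. g t * ennreal (?Z (x - t) / ?Z L) * indicator {0..x} t \<partial>lborel)"
    \<comment> \<open>For \<open>t > x\<close> the normalizing constant vanishes at
      \<open>x - t\<close>, so the cutoff \<open>b \<le> L\<close> may be replaced by
      \<open>t \<le> x\<close>.\<close>
    apply (subst nn_integral_real_affine[where c=1 and t=a])
    subgoal by measurable
    subgoal by simp
    subgoal using a norm_const_eq_0[OF ldf]
      by (auto intro!: nn_integral_cong simp: indicator_def not_le)
    done
  also have "\<dots> = (\<integral>\<^sup>+t. (g t * ennreal (?Z (x - t)) * indicator {0..x} t) / ennreal (?Z L) \<partial>lborel)"
    using pos norm_const_nonneg[OF ldf]
    by (intro nn_integral_cong) (simp add: divide_ennreal[symmetric] divide_ennreal_def mult_ac)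
  also have "\<dots> = gap_integral \<nu> g x / ennreal (?Z L)"
    unfolding gap_integral_def by (rule nn_integral_divide) measurable
  finally show ?thesis
    using pos L by (simp add: divide_ennreal_def ennreal_inverse_mult mult_ac)
qed

text \<open>For fixed length \<open>l\<close>, reflecting \<open>b\<close> to
  \<open>2 * a + x - l - b\<close> exchanges the two gaps and preserves the uniform law on the
  fitting positions. Hence the position is the inner variable here.\<close>

lemma nn_integral_right_gap:
  assumes [measurable]: "g \<in> borel_measurable borel" and a: "0 \<le> a" "0 \<le> x" "a + x \<le> L"
  shows "(\<integral>\<^sup>+p. (if a \<le> fst p \<and> fst p + snd p \<le> a + x then g (a + x - fst p - snd p) else 0) \<partial>segment_law \<nu> L)
    = (\<integral>\<^sup>+p. (if a \<le> fst p \<and> fst p + snd p \<le> a + x then g (fst p - a) else 0) \<partial>segment_law \<nu> L)"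
proof -
  have refl: "(\<integral>\<^sup>+b. (if a \<le> b \<and> b + l \<le> a + x then g (a + x - b - l) else 0) \<partial>uniform_measure lborel {0..L})
      = (\<integral>\<^sup>+b. (if a \<le> b \<and> b + l \<le> a + x then g (b - a) else 0) \<partial>uniform_measure lborel {0..L})"
    if "1 < l" for l
  proof -
    have "(\<integral>\<^sup>+b. (if a \<le> b \<and> b + l \<le> a + x then g (b - a) else 0) * indicator {0..L} b \<partial>lborel)
       = (\<integral>\<^sup>+b. (if a \<le> b \<and> b + l \<le> a + x then g (a + x - b - l) else 0) * indicator {0..L} b \<partial>lborel)"
      apply (subst nn_integral_real_affine[where c="-1" and t="2 * a + x - l"])
      subgoal by measurable
      subgoal by simp
      subgoal using a that
        by (auto intro!: nn_integral_cong arg_cong[where f=g] simp: indicator_def)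
      done
    then show ?thesis by (simp add: nn_integral_uniform)
  qed
  show ?thesis
    unfolding segment_law_def
    apply (subst (1 2) Seg.nn_integral_snd[symmetric])
    apply (simp_all cong: if_cong)
    apply (rule nn_integral_cong_AE)
    using AE_length_law apply eventually_elim
    by (rule refl)
qed

end

subsection \<open>The recursion for the expected empty space\<close>

context rsa_process
begin

definition mean_empty :: "real set \<Rightarrow> ennreal" where
  "mean_empty I = (\<integral>\<^sup>+\<omega>. ennreal (empty_limit I \<omega>) \<partial>rsa_space \<nu> L)"

lemma prob_space_rsa: "prob_space (rsa_space \<nu> L)"
  by (rule prob_space_rsa_space[OF ldf L])

lemma borel_measurable_empty_limit_rsa [measurable]:
  "compact I \<Longrightarrow> empty_limit I \<in> borel_measurable (rsa_space \<nu> L)"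
  unfolding rsa_space_def
  by (rule borel_measurable_empty_limit[OF measurable_fst_segment_law measurable_snd_segment_law])

lemma mean_empty_le:
  assumes "compact I"
  shows "mean_empty I \<le> ennreal (measure lborel I)"
proof -
  interpret prob_space "rsa_space \<nu> L" by (rule prob_space_rsa)
  have "mean_empty I \<le> (\<integral>\<^sup>+\<omega>. ennreal (measure lborel I) \<partial>rsa_space \<nu> L)"
    unfolding mean_empty_def by (intro nn_integral_mono ennreal_leI empty_limit_le assms)
  then show ?thesis by (simp add: emeasure_space_1)
qed

text \<open>After the first proposal the remaining stream has the same law again and acts on the
  updated set.\<close>

lemma mean_empty_park:
  assumes "compact I"
  shows "mean_empty I = (\<integral>\<^sup>+p. mean_empty (park I p) \<partial>segment_law \<nu> L)"
proof -
  interpret prob_space "segment_law \<nu> L" by (rule prob_space_segment_law)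
  have "(\<lambda>\<omega>. ennreal (empty_limit I \<omega>)) \<in> borel_measurable (stream_space (segment_law \<nu> L))"
    using borel_measurable_empty_limit_rsa[OF assms] unfolding rsa_space_def by measurable
  from nn_integral_stream_space[OF this] show ?thesis
    by (simp add: mean_empty_def rsa_space_def empty_limit_Stream[OF assms])
qed

lemma mean_empty_Un:
  assumes "compact I" "compact J" "I \<subseteq> {..c}" "J \<subseteq> {d..}" "c < d"
  shows "mean_empty (I \<union> J) = mean_empty I + mean_empty J"
  unfolding mean_empty_def empty_limit_separated_Un[OF assms]
  using assms(1,2) empty_limit_nonneg
  by (subst nn_integral_add[symmetric]) (auto intro!: nn_integral_cong ennreal_plus)

text \<open>Base of the recursion: almost surely every proposed length exceeds 1, so nothing ever
  fits.\<close>

lemma mean_empty_small: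
  assumes "0 \<le> x" "x \<le> 1"
  shows "mean_empty {a..a + x} = ennreal x"
proof -
  interpret S: prob_space "segment_law \<nu> L" by (rule prob_space_segment_law)
  interpret R: prob_space "rsa_space \<nu> L" by (rule prob_space_rsa)
  have "AE \<omega> in rsa_space \<nu> L. stream_all (\<lambda>p. 1 < snd p) \<omega>"
    unfolding rsa_space_def by (rule S.AE_stream_all[OF _ AE_segment_law]) measurable
  then have "AE \<omega> in rsa_space \<nu> L. empty_limit {a..a + x} \<omega> = x"
  proof eventually_elim
    case (elim \<omega>)
    have "unoccupied {a..a + x} \<omega> T = {a..a + x}" for T
    proof (induction T)
      case (Suc T)
      obtain b l where bl: "\<omega> !! T = (b, l)" by fastforce
      then have "1 < l" using elim by (metis snd_conv stream_all_def)
      then have "\<not> {b<..<b + l} \<subseteq> {a..a + x}"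
        using assms by (auto simp: greaterThanLessThan_subseteq_atLeastAtMost_iff)
      then show ?case using Suc by (simp add: park_def bl)
    qed simp
    then show ?case using assms by (simp add: empty_limit_def)
  qed
  then have "mean_empty {a..a + x} = (\<integral>\<^sup>+\<omega>. ennreal x \<partial>rsa_space \<nu> L)"
    unfolding mean_empty_def by (intro nn_integral_cong_AE) (auto elim: eventually_mono)
  then show ?thesis by (simp add: R.emeasure_space_1)
qed

text \<open>Proposals are drawn from the law for \<open>[0, L]\<close> also when only the gap \<open>{a..a + x}\<close> is observed.
  Those that do not fit cancel from the equation obtained by conditioning on the first proposal,
  so that neither \<open>a\<close> nor \<open>L\<close> survives in the recursion.\<close>

lemma mean_empty_recursion:
  assumes [measurable]: "g \<in> borel_measurable borel"
    and a: "0 \<le> a" and x: "1 < x" and ax: "a + x \<le> L"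
    and IH: "\<And>a y. 0 \<le> a \<Longrightarrow> 0 \<le> y \<Longrightarrow> y \<le> x - 1 \<Longrightarrow> a + y \<le> L \<Longrightarrow> mean_empty {a..a + y} = g y"
  shows "mean_empty {a..a + x} * gap_integral \<nu> (\<lambda>_. 1) x = 2 * gap_integral \<nu> g x"
proof -
  let ?I = "{a..a + x}"
  define acc where "acc p \<longleftrightarrow> a \<le> fst p \<and> fst p + snd p \<le> a + x" for p :: "real \<times> real"
  have [measurable]: "Measurable.pred (segment_law \<nu> L) acc"
    unfolding acc_def by measurable
  have step: "mean_empty (park ?I p) =
      (if acc p then g (fst p - a) + g (a + x - fst p - snd p) else mean_empty ?I)" if snd_gt: "1 < snd p" for p
  proof -
    obtain b l where p: "p = (b, l)" "1 < l" using snd_gt by (metis prod.collapse)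
    have acc: "acc p \<longleftrightarrow> {b<..<b + l} \<subseteq> ?I"
      using p by (auto simp: acc_def greaterThanLessThan_subseteq_atLeastAtMost_iff)
    show ?thesis
    proof (cases "acc p")
      case True
      then have bl: "a \<le> b" "b + l \<le> a + x" using p by (auto simp: acc_def)
      \<comment> \<open>Both gaps are written in the form \<open>{a..a + y}\<close> required by
        \<open>IH\<close>; they have length at most \<open>x - 1\<close> because the parked length
        exceeds 1.\<close>
      have "park ?I p = {a..a + (b - a)} \<union> {b + l..(b + l) + (a + x - b - l)}"
        using acc True p bl by (auto simp: park_def)
      also have "mean_empty \<dots> = mean_empty {a..a + (b - a)} + mean_empty {b + l..(b + l) + (a + x - b - l)}"
        using p by (intro mean_empty_Un[of _ _ b "b + l"]) auto
      also have "\<dots> = g (b - a) + g (a + x - b - l)"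
        using bl p a ax by (intro arg_cong2[where f="(+)"] IH) auto
      finally show ?thesis using True p by simp
    next
      case False
      then show ?thesis using acc p by (simp add: park_def)
    qed
  qed
  have fin: "mean_empty ?I \<noteq> \<infinity>"
    using mean_empty_le[of ?I] by (auto simp: top_unique)
  interpret prob_space "segment_law \<nu> L" by (rule prob_space_segment_law)
  let ?rej = "\<integral>\<^sup>+p. mean_empty ?I * (if acc p then 0 else 1) \<partial>segment_law \<nu> L"
  let ?left = "\<integral>\<^sup>+p. (if acc p then g (fst p - a) else 0) \<partial>segment_law \<nu> L"
  let ?P = "\<integral>\<^sup>+p. (if acc p then 1 else 0) \<partial>segment_law \<nu> L"
  define c where "c = ennreal (norm_const \<nu> L) * ennreal L"
  have left: "?left = gap_integral \<nu> g x / c"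
    unfolding acc_def c_def by (rule nn_integral_left_gap) (use a x ax in auto)
  have P: "?P = gap_integral \<nu> (\<lambda>_. 1) x / c"
    unfolding acc_def c_def by (rule nn_integral_left_gap) (use a x ax in auto)
  have right: "(\<integral>\<^sup>+p. (if acc p then g (a + x - fst p - snd p) else 0) \<partial>segment_law \<nu> L) = ?left"
    unfolding acc_def by (rule nn_integral_right_gap) (use a x ax in auto)
  have "mean_empty ?I = (\<integral>\<^sup>+p. mean_empty (park ?I p) \<partial>segment_law \<nu> L)"
    by (rule mean_empty_park) simp
  also have "\<dots> = (\<integral>\<^sup>+p. ((if acc p then g (fst p - a) else 0)
       + (if acc p then g (a + x - fst p - snd p) else 0)) + mean_empty ?I * (if acc p then 0 else 1) \<partial>segment_law \<nu> L)"
    using AE_segment_law by (intro nn_integral_cong_AE) (auto elim!: eventually_mono simp: step)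
  also have "\<dots> = (?left + ?left) + ?rej"
    by (subst nn_integral_add) (auto simp: nn_integral_add right)
  finally have 1: "mean_empty ?I = (?left + ?left) + ?rej" .
  \<comment> \<open>The constant is split by acceptance as well, so that the rejected part occurs in
    both expressions.\<close>
  have "mean_empty ?I = (\<integral>\<^sup>+p. mean_empty ?I \<partial>segment_law \<nu> L)"
    by (simp only: nn_integral_const emeasure_space_1 mult_1_right)
  also have "\<dots> = (\<integral>\<^sup>+p. mean_empty ?I * (if acc p then 1 else 0) + mean_empty ?I * (if acc p then 0 else 1) \<partial>segment_law \<nu> L)"
    by (intro nn_integral_cong) auto
  also have "\<dots> = mean_empty ?I * ?P + ?rej"
    by (subst nn_integral_add) (auto simp: nn_integral_cmult)
  finally have 2: "mean_empty ?I = mean_empty ?I * ?P + ?rej" .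
  \<comment> \<open>Cancellation in the extended reals requires the cancelled term to be
    finite.\<close>
  have "?rej \<noteq> \<infinity>" using 2 fin by (metis ennreal_add_eq_top infinity_ennreal_def)
  moreover have "?rej + mean_empty ?I * ?P = ?rej + (?left + ?left)"
    unfolding add.commute[of ?rej] by (rule trans[OF 2[symmetric] 1])
  ultimately have "mean_empty ?I * ?P = ?left + ?left"
    unfolding ennreal_add_left_cancel by blast
  then have "mean_empty ?I * gap_integral \<nu> (\<lambda>_. 1) x / c = 2 * gap_integral \<nu> g x / c"
    unfolding P left by (simp add: divide_ennreal_def mult_2 distrib_right mult.assoc)
  moreover have "c \<noteq> 0" "c \<noteq> \<infinity>" unfolding c_def 
    using norm_const_pos[OF ldf L] L by (auto simp: ennreal_mult_eq_top_iff)
  ultimately show ?thesis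
    by (metis ennreal_divide_times ennreal_divide_self mult.right_neutral infinity_ennreal_def less_top)
qed

end

section \<open>Identification with the expected empty space\<close>

lemma expected_empty_space_eq:
  assumes "ldf \<nu>" "x > 1"
  shows "ennreal (expected_empty_space \<nu> x) = rsa_process.mean_empty \<nu> x {0..x}"
    and "0 \<le> expected_empty_space \<nu> x" "expected_empty_space \<nu> x \<le> x"
proof -
  interpret rsa_process \<nu> x by unfold_locales (use assms in auto)
  interpret prob_space "rsa_space \<nu> x" by (rule prob_space_rsa)
  have bd: "0 \<le> empty_limit {0..x} \<omega>" "empty_limit {0..x} \<omega> \<le> x" for \<omega>
    using empty_limit_nonneg[of "{0..x}" \<omega>] empty_limit_le[of "{0..x}" \<omega>] assms(2) by auto
  have int: "integrable (rsa_space \<nu> x) (empty_limit {0..x})"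
    by (rule integrable_const_bound[where B=x]) (use bd in auto)
  show "ennreal (expected_empty_space \<nu> x) = mean_empty {0..x}"
    using assms(2) nn_integral_eq_integral[OF int] bd
    by (simp add: expected_empty_space_def empty_space_eq mean_empty_def)
  show "0 \<le> expected_empty_space \<nu> x" "expected_empty_space \<nu> x \<le> x"
    using assms(2) bd by (auto simp: expected_empty_space_def empty_space_eq intro: integral_le_const[OF int])
qed

lemma expected_empty_space_le_1: "x \<le> 1 \<Longrightarrow> expected_empty_space \<nu> x = x"
  by (simp add: expected_empty_space_def)

lemma expected_empty_space_bounds:
  assumes "ldf \<nu>" "0 \<le> x"
  shows "0 \<le> expected_empty_space \<nu> x" "expected_empty_space \<nu> x \<le> x"
  using assms expected_empty_space_eq(2,3)[of \<nu> x]
  by (cases "x \<le> 1"; simp add: expected_empty_space_def)+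

text \<open>Steps of 1 suffice, since gaps left in an interval of length \<open>x\<close> have
  length at most \<open>x - 1\<close>. Values agree because both sides solve one equation whose
  coefficient is positive and finite. Measurability is carried along: the recursion integrates over
  shorter lengths, and in turn yields measurability on the longer range.\<close>

lemma mean_empty_eq_expected_empty_space:
  assumes ldf: "ldf \<nu>"
  shows "(\<forall>L a x. 1 < L \<longrightarrow> 0 \<le> a \<longrightarrow> 0 \<le> x \<longrightarrow> x \<le> 1 + real n \<longrightarrow> a + x \<le> L \<longrightarrow>
       rsa_process.mean_empty \<nu> L {a..a + x} = ennreal (expected_empty_space \<nu> x)) \<and>
     (\<lambda>x. expected_empty_space \<nu> x * indicator {0..1 + real n} x) \<in> borel_measurable borel"
proof (induction n)
  case 0
  have "(\<lambda>x. expected_empty_space \<nu> x * indicator {0..1} x) = (\<lambda>x. x * indicator {0..1} x)"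
    by (auto simp: expected_empty_space_def indicator_def)
  then show ?case
    using rsa_process.mean_empty_small[of \<nu>] ldf
    by (auto simp: rsa_process_def expected_empty_space_def)
next
  case (Suc n)
  define g where "g x = ennreal (expected_empty_space \<nu> x * indicator {0..1 + real n} x)" for x
  have g[measurable]: "g \<in> borel_measurable borel"
    unfolding g_def by (rule measurable_compose[OF conjunct2[OF Suc.IH] measurable_ennreal])
  have rec: "rsa_process.mean_empty \<nu> L {a..a + x} * gap_integral \<nu> (\<lambda>_. 1) x = 2 * gap_integral \<nu> g x"
    if "1 < L" "0 \<le> a" "1 < x" "x \<le> 1 + real (Suc n)" "a + x \<le> L" for L a x
  proof -
    interpret rsa_process \<nu> L by unfold_locales (use that ldf in auto)
    show ?thesis
      by (rule mean_empty_recursion) (use that Suc.IH in \<open>auto simp: g_def\<close>)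
  qed
  have cancel: "u = v" if "u * gap_integral \<nu> (\<lambda>_. 1) x = v * gap_integral \<nu> (\<lambda>_. 1) x" "1 < x" for u v x
    using that gap_integral_1_pos[OF ldf \<open>1 < x\<close>] gap_integral_1_finite[OF ldf, of x]
    by (metis ennreal_mult_cancel_left mult.commute infinity_ennreal_def less_irrefl)
  have eq: "rsa_process.mean_empty \<nu> L {a..a + x} = ennreal (expected_empty_space \<nu> x)"
    if "1 < L" "0 \<le> a" "0 \<le> x" "x \<le> 1 + real (Suc n)" "a + x \<le> L" for L a x
  proof (cases "x \<le> 1")
    case True
    then show ?thesis using Suc.IH that by auto
  next
    case False
    then have x: "1 < x" by simp
    \<comment> \<open>The case \<open>L = x\<close>, \<open>a = 0\<close> is the process that
      defines \<open>expected_empty_space \<nu> x\<close>.\<close>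
    have "ennreal (expected_empty_space \<nu> x) * gap_integral \<nu> (\<lambda>_. 1) x = 2 * gap_integral \<nu> g x"
      using rec[of x 0 x] that x by (simp add: expected_empty_space_eq(1)[OF ldf x])
    from cancel[OF trans[OF rec[OF that(1,2) x that(4,5)] this[symmetric]] x] show ?thesis .
  qed
  \<comment> \<open>Solving the recursion exhibits the function on the new range as a quotient of
    measurable functions.\<close>
  have "expected_empty_space \<nu> x = enn2real (2 * gap_integral \<nu> g x / gap_integral \<nu> (\<lambda>_. 1) x)"
    if "1 < x" "x \<le> 1 + real (Suc n)" for x
  proof -
    have "ennreal (expected_empty_space \<nu> x) * gap_integral \<nu> (\<lambda>_. 1) x = 2 * gap_integral \<nu> g x"
      using rec[of x 0 x] that by (simp add: expected_empty_space_eq(1)[OF ldf \<open>1 < x\<close>])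
    then have "2 * gap_integral \<nu> g x / gap_integral \<nu> (\<lambda>_. 1) x = ennreal (expected_empty_space \<nu> x)"
      using gap_integral_1_pos[OF ldf \<open>1 < x\<close>] gap_integral_1_finite[OF ldf, of x]
      by (metis mult_divide_eq_ennreal infinity_ennreal_def less_irrefl)
    then show ?thesis using expected_empty_space_eq(2)[OF ldf \<open>1 < x\<close>] by simp
  qed
  then have "(\<lambda>x. expected_empty_space \<nu> x * indicator {0..1 + real (Suc n)} x)
     = (\<lambda>x. if 0 \<le> x \<and> x \<le> 1 then x else if 1 < x \<and> x \<le> 1 + real (Suc n) then
          enn2real (2 * gap_integral \<nu> g x / gap_integral \<nu> (\<lambda>_. 1) x) else 0)"
    by (auto simp: expected_empty_space_def[of \<nu> x for x] indicator_def fun_eq_iff)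
  then have "(\<lambda>x. expected_empty_space \<nu> x * indicator {0..1 + real (Suc n)} x) \<in> borel_measurable borel"
    using borel_measurable_gap_integral[OF ldf, measurable] by simp
  with eq show ?case by blast
qed

lemma borel_measurable_expected_empty_space:
  assumes "ldf \<nu>"
  shows "expected_empty_space \<nu> \<in> borel_measurable borel"
proof -
  \<comment> \<open>The second summand supplies the negative arguments, where the function is the
    identity by convention.\<close>
  have *: "(\<lambda>x. expected_empty_space \<nu> x * indicator {0..1 + real n} x + x * indicator {..<0} x) \<in> borel_measurable borel" for n
    using mean_empty_eq_expected_empty_space[OF assms, of n] by (intro borel_measurable_add) auto
  show ?thesis
  proof (rule borel_measurable_LIMSEQ_real[OF _ *])
    fix x :: real
    have "\<forall>\<^sub>F n in sequentially. expected_empty_space \<nu> x * indicator {0..1 + real n} x + x * indicator {..<0} x = expected_empty_space \<nu> x"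
      using eventually_ge_at_top[of "nat \<lceil>x\<rceil>"]
      by eventually_elim (auto simp: indicator_def expected_empty_space_def nat_ceiling_le_eq)
    then show "(\<lambda>n. expected_empty_space \<nu> x * indicator {0..1 + real n} x + x * indicator {..<0} x) \<longlonglongrightarrow> expected_empty_space \<nu> x"
      by (rule tendsto_eventually)
  qed
qed

lemma expected_empty_space_recursion:
  assumes ldf: "ldf \<nu>" and "1 < x"
  shows "ennreal (expected_empty_space \<nu> x) * gap_integral \<nu> (\<lambda>_. 1) x =
     2 * gap_integral \<nu> (\<lambda>t. ennreal (expected_empty_space \<nu> t)) x"
proof -
  interpret rsa_process \<nu> x by unfold_locales (use assms in auto)
  have "mean_empty {0..0 + x} * gap_integral \<nu> (\<lambda>_. 1) x =
     2 * gap_integral \<nu> (\<lambda>t. ennreal (expected_empty_space \<nu> t)) x"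
  proof (rule mean_empty_recursion)
    fix a y assume "0 \<le> a" "0 \<le> y" "y \<le> x - 1" "a + y \<le> x"
    then show "mean_empty {a..a + y} = ennreal (expected_empty_space \<nu> y)"
      using mean_empty_eq_expected_empty_space[OF ldf, of "nat \<lceil>y\<rceil>"] \<open>1 < x\<close>
      by (simp add: add_increasing real_nat_ceiling_ge)
  qed (use assms borel_measurable_expected_empty_space[OF ldf] in auto)
  then show ?thesis by (simp add: expected_empty_space_eq(1)[OF assms])
qed

subsection \<open>Asymptotics of solutions of the recursion\<close>

lemma bounded_measurable_integrable_on:
  fixes f :: "real \<Rightarrow> real"
  assumes "f \<in> borel_measurable borel" "\<And>x. x \<in> {a..b} \<Longrightarrow> \<bar>f x\<bar> \<le> B"
  shows "f integrable_on {a..b}"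
proof -
  have "set_integrable lborel {a..b} f"
    unfolding set_integrable_def using assms
    by (intro integrableI_bounded_set_indicator[where B=B]) (auto simp: emeasure_lborel_Icc_eq)
  then show ?thesis by (rule set_borel_integral_eq_integral)
qed

lemma integral_reflect_Icc:
  fixes f :: "real \<Rightarrow> real"
  shows "integral {0..x} (\<lambda>t. f (x - t)) = integral {0..x} f"
  using integral_shift_real_ivl[of "-x" "-x" 0 "\<lambda>s. f (- s)"] Henstock_Kurzweil_Integration.integral_reflect_real[of x 0 f]
  by simp

lemma mono_bounded_tendsto_at_top:
  fixes f :: "real \<Rightarrow> real"
  assumes mono: "\<And>x y. a \<le> x \<Longrightarrow> x \<le> y \<Longrightarrow> f x \<le> f y" and bd: "\<And>x. a \<le> x \<Longrightarrow> f x \<le> B"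
  shows "\<exists>l. (f \<longlongrightarrow> l) at_top"
proof -
  \<comment> \<open>Freezing \<open>f\<close> to the left of \<open>a\<close> makes it monotone on
    the whole line.\<close>
  define g where "g x = f (max a x)" for x
  have "mono g" unfolding g_def by (intro monoI mono) auto
  have "Bseq (\<lambda>n. g (real n))"
  proof (rule BseqI')
    fix n
    have "f a \<le> g (real n)" "g (real n) \<le> B" unfolding g_def by (auto intro: mono bd)
    then show "norm (g (real n)) \<le> max \<bar>f a\<bar> \<bar>B\<bar>" by auto
  qed
  then have "convergent (\<lambda>n. g (real n))"
    using \<open>mono g\<close> by (intro Bseq_mono_convergent) (auto simp: mono_def)
  then obtain l where "(\<lambda>n. g (real n)) \<longlonglongrightarrow> l" by (auto simp: convergent_def)
  then have "(g \<longlongrightarrow> l) at_top" by (rule tendsto_at_topI_sequentially_real[OF \<open>mono g\<close>])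
  moreover have "\<forall>\<^sub>F x in at_top. g x = f x"
    using eventually_ge_at_top[of a] by eventually_elim (simp add: g_def)
  ultimately show ?thesis using tendsto_cong by blast
qed

text \<open>Continuity is asked for at \<open>x\<close> only, with a view to \<open>S\<close>, which
  jumps at 1: the recursion forces \<open>S x \<le> 2 * (x - 1)\<close> just beyond 1, while
  \<open>S 1 = 1\<close>.\<close>

lemma has_real_derivative_integral:
  fixes f :: "real \<Rightarrow> real"
  assumes int: "\<And>b. f integrable_on {a..b}" and cont: "isCont f x" and x: "a < x"
  shows "((\<lambda>x. integral {a..x} f) has_real_derivative f x) (at x)"
proof -
  have "((\<lambda>u. integral {a..u} f) has_vector_derivative f x) (at x within {a..x + 1})"
    using integral_has_vector_derivative_continuous_at[OF int[of "x + 1"], of x "{}"] x cont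
    by (auto simp: continuous_at_imp_continuous_within)
  moreover have "at x within {a..x + 1} = at x"
    by (rule at_within_interior) (use x in simp)
  ultimately show ?thesis
    by (simp add: has_real_derivative_iff_has_vector_derivative)
qed

text \<open>All that the asymptotic analysis uses of the process. \<open>tail_bounded\<close>
  expresses the integrability of a nonnegative function through its partial integrals.\<close>

locale gap_equation =
  fixes Z S :: "real \<Rightarrow> real"
  assumes Z_cont: "continuous_on UNIV Z"
    and Z_mono: "mono Z"
    and Z_0: "\<And>x. x \<le> 1 \<Longrightarrow> Z x = 0"
    and Z_pos: "\<And>x. x > 1 \<Longrightarrow> Z x > 0"
    and Z_tendsto: "(Z \<longlongrightarrow> 1) at_top"
    and tail_bounded: "\<exists>C. \<forall>x\<ge>1. integral {1..x} (\<lambda>t. (1 - Z t) / t) \<le> C"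
    and S_measurable: "S \<in> borel_measurable borel"
    and S_nonneg: "\<And>x. x \<ge> 0 \<Longrightarrow> 0 \<le> S x"
    and S_le: "\<And>x. x \<ge> 0 \<Longrightarrow> S x \<le> x"
    and S_id: "\<And>x. 0 \<le> x \<Longrightarrow> x \<le> 1 \<Longrightarrow> S x = x"
    and S_rec: "\<And>x. x > 1 \<Longrightarrow> S x * integral {0..x} Z = 2 * integral {0..x} (\<lambda>t. S t * Z (x - t))"
begin

definition R where "R x = 1 - Z x"
definition M where "M x = integral {0..x} R"
definition F where "F x = integral {0..x} S"
definition E where "E x = integral {0..x} (\<lambda>t. S t * R (x - t))"

section \<open>Bounds for the functions in the integral equation\<close>

lemma Z_nonneg: "0 \<le> Z x" using Z_0[of x] Z_pos[of x] by fastforce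

lemma Z_le_1: "Z x \<le> 1"
proof -
  have "\<forall>\<^sub>F y in at_top. Z x \<le> Z y"
    using eventually_ge_at_top[of x] by eventually_elim (use Z_mono in \<open>simp add: monoD\<close>)
  then show ?thesis by (intro tendsto_lowerbound[OF Z_tendsto]) auto
qed

lemma R_nonneg: "0 \<le> R x" and R_le_1: "R x \<le> 1"
  using Z_nonneg[of x] Z_le_1[of x] by (auto simp: R_def)

lemma isCont_Z: "isCont Z x" using Z_cont by (simp add: continuous_on_eq_continuous_at)

lemma isCont_R: "isCont R x" unfolding R_def by (intro continuous_intros isCont_Z)

lemma R_cont: "continuous_on A R"
  by (simp add: continuous_at_imp_continuous_on isCont_R)

lemma Z_measurable [measurable]: "Z \<in> borel_measurable borel"
  by (rule borel_measurable_continuous_onI[OF Z_cont])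

lemma R_measurable [measurable]: "R \<in> borel_measurable borel"
  unfolding R_def by measurable

declare S_measurable [measurable]

lemma R_integrable: "R integrable_on {a..b}"
  by (rule integrable_continuous_real[OF R_cont])

lemma S_integrable: "0 \<le> a \<Longrightarrow> S integrable_on {a..b}"
proof (rule bounded_measurable_integrable_on[where B=b])
  fix x assume "0 \<le> a" "x \<in> {a..b}"
  then show "\<bar>S x\<bar> \<le> b" using S_nonneg[of x] S_le[of x] by simp
qed measurable

lemma SR_bound: "0 \<le> t \<Longrightarrow> t \<le> n \<Longrightarrow> 0 \<le> S t * R u \<and> S t * R u \<le> n * R u"
  using S_nonneg[of t] S_le[of t] R_nonneg[of u] by (auto intro!: mult_right_mono)

lemma SZ_bound: "0 \<le> t \<Longrightarrow> t \<le> n \<Longrightarrow> 0 \<le> S t * Z u \<and> S t * Z u \<le> n"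
  using S_nonneg[of t] S_le[of t] Z_nonneg[of u] Z_le_1[of u] mult_mono[of "S t" n "Z u" 1] by auto

lemma SR_integrable: "0 \<le> a \<Longrightarrow> (\<lambda>t. S t * R (x - t)) integrable_on {a..b}"
proof (rule bounded_measurable_integrable_on[where B=b])
  fix t assume "0 \<le> a" "t \<in> {a..b}"
  then show "\<bar>S t * R (x - t)\<bar> \<le> b"
    using SR_bound[of t b "x - t"] R_le_1[of "x - t"] mult_left_mono[of "R (x - t)" 1 b] by auto
qed measurable

lemma SZ_integrable: "0 \<le> a \<Longrightarrow> (\<lambda>t. S t * Z (x - t)) integrable_on {a..b}"
proof (rule bounded_measurable_integrable_on[where B=b])
  fix t assume "0 \<le> a" "t \<in> {a..b}"
  then show "\<bar>S t * Z (x - t)\<bar> \<le> b" using SZ_bound[of t b "x - t"] by auto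
qed measurable

lemma E_eq: "E x = F x - integral {0..x} (\<lambda>t. S t * Z (x - t))"
  unfolding E_def F_def R_def
  by (subst integral_diff[symmetric]) (auto simp: algebra_simps intro: S_integrable SZ_integrable)

lemma M_eq: "0 \<le> x \<Longrightarrow> M x = x - integral {0..x} Z"
  unfolding M_def R_def
  by (subst integral_diff) (auto intro!: integrable_continuous_real continuous_on_subset[OF Z_cont])

lemma M_nonneg: "0 \<le> M x"
  unfolding M_def by (intro integral_nonneg R_integrable R_nonneg)

lemma E_nonneg: "0 \<le> E x"
  unfolding E_def by (rule integral_nonneg[OF SR_integrable]) (use SR_bound in auto)

lemma E_le: "0 \<le> x \<Longrightarrow> E x \<le> x * M x"
proof -
  assume x: "0 \<le> x"
  have "E x \<le> integral {0..x} (\<lambda>t. x * R (x - t))"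
    unfolding E_def using SR_bound
    by (intro integral_le SR_integrable integrable_continuous_real continuous_intros
        continuous_on_compose2[OF R_cont[of UNIV]]) auto
  also have "\<dots> = x * M x"
    using integral_reflect_Icc[of x R] by (simp add: M_def)
  finally show ?thesis .
qed

lemma F_nonneg: "0 \<le> F x"
  unfolding F_def by (intro integral_nonneg S_integrable S_nonneg) auto

lemma F_mono: "0 \<le> x \<Longrightarrow> x \<le> y \<Longrightarrow> F x \<le> F y"
  unfolding F_def by (intro integral_subset_le S_integrable) (auto intro: S_nonneg)

lemma F_le: "0 \<le> x \<Longrightarrow> F x \<le> x\<^sup>2"
proof -
  assume x: "0 \<le> x"
  have "S t \<le> x" if "t \<in> {0..x}" for t using S_le[of t] that by simp
  then have "F x \<le> integral {0..x} (\<lambda>t. x)"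
    unfolding F_def by (intro integral_le S_integrable) auto
  then show ?thesis using x by (simp add: power2_eq_square)
qed

lemma F_1: "F 1 = 1 / 2"
proof -
  have "F 1 = integral {0..1} (\<lambda>t. t)"
    unfolding F_def by (rule integral_cong) (simp add: S_id)
  also have "\<dots> = 1 / 2"
    by (intro integral_unique) (use ident_has_integral[of 0 1] in simp)
  finally show ?thesis .
qed

text \<open>\<open>Z\<close> vanishes at nonpositive arguments, so the upper limit may be replaced
  by the fixed \<open>b\<close>; dominated convergence then transfers the continuity of
  \<open>Z\<close>.\<close>

lemma conv_continuous: "continuous_on {0..b} (\<lambda>x. integral {0..x} (\<lambda>t. S t * Z (x - t)))"
proof -
  have eq: "integral {0..x} (\<lambda>t. S t * Z (x - t)) = integral {0..b} (\<lambda>t. S t * Z (x - t))"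
    if "x \<in> {0..b}" for x
  proof -
    have "integral {x..b} (\<lambda>t. S t * Z (x - t)) = integral {x..b} (\<lambda>t. 0)"
      by (rule integral_cong) (simp add: Z_0)
    then show ?thesis
      using Henstock_Kurzweil_Integration.integral_combine[of 0 x b "\<lambda>t. S t * Z (x - t)"] that SZ_integrable[of 0 x b]
      by simp
  qed
  have "continuous_on {0..b} (\<lambda>x. integral {0..b} (\<lambda>t. S t * Z (x - t)))"
  proof (rule continuous_on_sequentiallyI)
    fix u :: "nat \<Rightarrow> real" and a assume u: "u \<longlonglongrightarrow> a"
    show "(\<lambda>n. integral {0..b} (\<lambda>t. S t * Z (u n - t))) \<longlonglongrightarrow> integral {0..b} (\<lambda>t. S t * Z (a - t))"
    proof (rule dominated_convergence(2))
      show "(\<lambda>t. S t * Z (u k - t)) integrable_on {0..b}" for k by (rule SZ_integrable) simp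
      show "(\<lambda>t. b) integrable_on {0..b}" by (rule integrable_const_ivl)
      show "norm (S t * Z (u k - t)) \<le> b" if "t \<in> {0..b}" for k t
        using SZ_bound[of t b "u k - t"] that by auto
      show "(\<lambda>k. S t * Z (u k - t)) \<longlonglongrightarrow> S t * Z (a - t)" for t
        by (intro tendsto_intros isCont_tendsto_compose[OF isCont_Z] u)
    qed
  qed
  then show ?thesis by (rule continuous_on_eq) (simp add: eq)
qed

lemma F_continuous: "continuous_on {0..b} F"
  unfolding F_def by (rule indefinite_integral_continuous_1[OF S_integrable]) simp

lemma E_continuous: "continuous_on {0..b} E"
  unfolding E_eq by (intro continuous_intros F_continuous conv_continuous)

lemma isCont_E: "0 < x \<Longrightarrow> isCont E x"
  using continuous_on_interior[OF E_continuous[of "x + 1"], of x] by simp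

lemma W_pos: "1 < x \<Longrightarrow> 0 < integral {0..x} Z"
proof -
  assume x: "1 < x"
  have Zi: "Z integrable_on {a..b}" for a b
    by (rule integrable_continuous_real[OF continuous_on_subset[OF Z_cont]]) simp
  have "0 < Z ((1 + x) / 2) * (x - (1 + x) / 2)" using x by (intro mult_pos_pos Z_pos) (auto simp: field_simps)
  also have "\<dots> = integral {(1 + x) / 2..x} (\<lambda>t. Z ((1 + x) / 2))"
    using x by (subst integral_const_real) (auto simp: field_simps)
  also have "\<dots> \<le> integral {(1 + x) / 2..x} Z"
    using Z_mono Zi by (intro integral_le) (auto simp: mono_def)
  also have "\<dots> \<le> integral {0..x} Z"
    using x Z_nonneg Zi by (intro integral_subset_le) auto
  finally show ?thesis .
qed

text \<open>Regularity comes from the recursion, which expresses \<open>S\<close> near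
  \<open>x > 1\<close> as a quotient of continuous functions with positive denominator.\<close>

lemma isCont_S: "1 < x \<Longrightarrow> isCont S x"
proof -
  assume x: "1 < x"
  have W: "continuous_on {0..b} (\<lambda>x. integral {0..x} Z)" for b
    by (intro indefinite_integral_continuous_1 integrable_continuous_real continuous_on_subset[OF Z_cont]) simp
  have "isCont (\<lambda>x. integral {0..x} Z) x" "isCont (\<lambda>x. integral {0..x} (\<lambda>t. S t * Z (x - t))) x"
    using continuous_on_interior[OF W[of "x + 1"], of x] 
      continuous_on_interior[OF conv_continuous[of "x + 1"], of x] x by simp_all
  then have "isCont (\<lambda>x. 2 * integral {0..x} (\<lambda>t. S t * Z (x - t)) / integral {0..x} Z) x"
    using W_pos[OF x] by (intro continuous_intros) auto
  moreover have "\<forall>\<^sub>F y in nhds x. 2 * integral {0..y} (\<lambda>t. S t * Z (y - t)) / integral {0..y} Z = S y"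
    using eventually_nhds_in_open[of "{1<..}" x, OF open_greaterThan]
  proof (rule eventually_mono)
    fix y :: real assume "y \<in> {1<..}"
    then show "2 * integral {0..y} (\<lambda>t. S t * Z (y - t)) / integral {0..y} Z = S y"
      using S_rec[of y] W_pos[of y] by (simp add: field_simps)
  qed (use x in simp)
  ultimately show ?thesis by (simp add: isCont_cong)
qed

lemma S_eq: "1 < x \<Longrightarrow> x * S x = 2 * F x - 2 * E x + S x * M x"
  using S_rec[of x] by (simp add: E_eq M_eq algebra_simps)

lemma F_deriv: "1 < x \<Longrightarrow> (F has_real_derivative S x) (at x)"
  unfolding F_def by (rule has_real_derivative_integral[OF S_integrable isCont_S]) auto

lemma M_deriv: "0 < x \<Longrightarrow> (M has_real_derivative R x) (at x)"
  unfolding M_def by (rule has_real_derivative_integral[OF R_integrable isCont_R])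

text \<open>A pointwise bound of \<open>E x\<close> by \<open>F x\<close> would require some monotonicity of \<open>S\<close>.
  The primitive \<open>N\<close> of \<open>E\<close> needs none, because \<open>N x\<close> is the integral of \<open>S t * M (x - t)\<close>.\<close>

definition N where "N x = integral {0..x} E"

lemma E_integrable: "E integrable_on {0..b}"
  by (rule integrable_continuous_real[OF E_continuous])

lemma N_deriv: "0 < x \<Longrightarrow> (N has_real_derivative E x) (at x)"
  unfolding N_def by (rule has_real_derivative_integral[OF E_integrable isCont_E])

lemma N_nonneg: "0 \<le> N x"
  unfolding N_def by (intro integral_nonneg E_integrable E_nonneg)

text \<open>Fubini over the triangle \<open>0 \<le> t \<le> u \<le> x\<close>: for fixed
  \<open>t\<close> the inner integral is \<open>S t * M (x - t)\<close>, hence at most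
  \<open>S t * M x\<close>.\<close>

lemma N_le: "0 \<le> x \<Longrightarrow> N x \<le> M x * F x"
proof -
  assume x: "0 \<le> x"
  have E: "ennreal (E u) = (\<integral>\<^sup>+t. ennreal (S t * R (u - t)) * indicator {0..u} t \<partial>lborel)" for u
    unfolding E_def
    by (rule nn_integral_has_integral_lebesgue'[symmetric, OF _ integrable_integral[OF SR_integrable]])
       (use SR_bound in auto)
  have "ennreal (N x) = (\<integral>\<^sup>+u. ennreal (E u) * indicator {0..x} u \<partial>lborel)"
    unfolding N_def
    by (rule nn_integral_has_integral_lebesgue'[symmetric, OF _ integrable_integral[OF E_integrable]])
       (use E_nonneg in auto)
  also have "\<dots> = (\<integral>\<^sup>+u. \<integral>\<^sup>+t. (if 0 \<le> t \<and> t \<le> u \<and> u \<le> x then ennreal (S t * R (u - t)) else 0) \<partial>lborel \<partial>lborel)"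
    unfolding E by (subst nn_integral_multc[symmetric])
      (auto intro!: nn_integral_cong simp: indicator_def)
  also have "\<dots> = (\<integral>\<^sup>+t. \<integral>\<^sup>+u. (if 0 \<le> t \<and> t \<le> u \<and> u \<le> x then ennreal (S t * R (u - t)) else 0) \<partial>lborel \<partial>lborel)"
    by (rule lborel_pair.Fubini') measurable
  also have "\<dots> \<le> (\<integral>\<^sup>+t. ennreal (S t) * indicator {0..x} t * ennreal (M x) \<partial>lborel)"
  proof (rule nn_integral_mono)
    fix t
    have "(\<integral>\<^sup>+u. (if 0 \<le> t \<and> t \<le> u \<and> u \<le> x then ennreal (S t * R (u - t)) else 0) \<partial>lborel)
       = (\<integral>\<^sup>+v. (if 0 \<le> t \<and> 0 \<le> v \<and> t + v \<le> x then ennreal (S t * R v) else 0) \<partial>lborel)"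
      by (subst nn_integral_real_affine[where c=1 and t=t]) (auto intro!: nn_integral_cong)
    also have "\<dots> \<le> (\<integral>\<^sup>+v. (ennreal (S t) * indicator {0..x} t) * (ennreal (R v) * indicator {0..x} v) \<partial>lborel)"
      using S_nonneg R_nonneg by (intro nn_integral_mono) (auto simp: ennreal_mult)
    also have "\<dots> = ennreal (S t) * indicator {0..x} t * (\<integral>\<^sup>+v. ennreal (R v) * indicator {0..x} v \<partial>lborel)"
      by (rule nn_integral_cmult) measurable
    also have "(\<integral>\<^sup>+v. ennreal (R v) * indicator {0..x} v \<partial>lborel) = ennreal (M x)"
      unfolding M_def
      by (rule nn_integral_has_integral_lebesgue'[OF _ integrable_integral[OF R_integrable]])
         (use R_nonneg in auto)
    finally show "(\<integral>\<^sup>+u. (if 0 \<le> t \<and> t \<le> u \<and> u \<le> x then ennreal (S t * R (u - t)) else 0) \<partial>lborel)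
       \<le> ennreal (S t) * indicator {0..x} t * ennreal (M x)" .
  qed
  also have "\<dots> = (\<integral>\<^sup>+t. ennreal (S t) * indicator {0..x} t \<partial>lborel) * ennreal (M x)"
    by (rule nn_integral_multc) measurable
  also have "(\<integral>\<^sup>+t. ennreal (S t) * indicator {0..x} t \<partial>lborel) = ennreal (F x)"
    unfolding F_def
    by (rule nn_integral_has_integral_lebesgue'[OF _ integrable_integral[OF S_integrable]])
       (use S_nonneg in auto)
  finally have "ennreal (N x) \<le> ennreal (M x * F x)"
    using F_nonneg M_nonneg by (simp add: ennreal_mult mult.commute)
  then show ?thesis using F_nonneg M_nonneg by (simp add: ennreal_le_iff)
qed

section \<open>Convergence and positivity of the limit\<close>

lemma M_over_x_tendsto: "((\<lambda>x. M x / x) \<longlongrightarrow> 0) at_top"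
proof (rule lhospital_at_top_at_top[where f'=R and g'="\<lambda>_. 1"])
  have "((\<lambda>x. R x) \<longlongrightarrow> 1 - 1) at_top" unfolding R_def by (intro tendsto_intros Z_tendsto)
  then show "((\<lambda>x. R x / 1) \<longlongrightarrow> 0) at_top" by simp
  show "\<forall>\<^sub>F x in at_top. (M has_real_derivative R x) (at x)"
    using eventually_gt_at_top[of 0] by eventually_elim (rule M_deriv)
qed (auto simp: filterlim_ident)

text \<open>This is the integral of \<open>M t / t\<^sup>2\<close> from 1 to \<open>x\<close> up to a constant, integrated by parts.\<close>

definition Q where "Q x = integral {1..x} (\<lambda>t. R t / t) - M x / x"

lemma Q_deriv: "1 < x \<Longrightarrow> (Q has_real_derivative M x / x\<^sup>2) (at x)"
proof -
  assume x: "1 < x"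
  have int: "(\<lambda>t. R t / t) integrable_on {1..b}" for b
    by (intro integrable_continuous_real continuous_intros R_cont) auto
  have "isCont (\<lambda>t. R t / t) x" using x by (intro continuous_intros isCont_R) auto
  from has_real_derivative_integral[OF int this x] M_deriv[of x] x
  show ?thesis unfolding Q_def
    by (auto intro!: derivative_eq_intros simp: power2_eq_square field_simps)
qed

text \<open>Here the tail condition enters; the subtracted \<open>M x / x\<close> is
  nonnegative.\<close>

lemma Q_bounded: "\<exists>C. \<forall>x\<ge>1. Q x \<le> C"
proof -
  from tail_bounded obtain C where C: "\<forall>x\<ge>1. integral {1..x} (\<lambda>t. R t / t) \<le> C"
    by (auto simp: R_def)
  have "Q x \<le> C" if "x \<ge> 1" for x
  proof -
    have "integral {1..x} (\<lambda>t. R t / t) \<le> C" "0 \<le> M x / x" using C that M_nonneg[of x] by auto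
    then show ?thesis unfolding Q_def by linarith
  qed
  then show ?thesis by blast
qed

text \<open>Substituting \<open>S_eq\<close> cancels \<open>F\<close>, so that only terms with
  \<open>M\<close> or \<open>E\<close> remain.\<close>

lemma G_deriv:
  "1 < x \<Longrightarrow> ((\<lambda>x. F x / x\<^sup>2) has_real_derivative (S x * M x - 2 * E x) / x ^ 3) (at x)"
proof -
  assume x: "1 < x"
  have "((\<lambda>x. F x / x\<^sup>2) has_real_derivative (x * S x - 2 * F x) / x ^ 3) (at x)"
    using x by (auto intro!: derivative_eq_intros F_deriv simp: field_simps power2_eq_square power3_eq_cube)
  then show ?thesis using S_eq[OF x] by simp
qed

lemma G_tendsto: "\<exists>g. ((\<lambda>x. F x / x\<^sup>2) \<longlongrightarrow> g) at_top"
proof -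
  obtain C where C: "\<And>x. x \<ge> 1 \<Longrightarrow> Q x \<le> C" using Q_bounded by blast
  have "\<exists>l. (Q \<longlongrightarrow> l) at_top"
  \<comment> \<open>The derivative formulas hold strictly beyond 1, so monotonicity is claimed from
    2 on.\<close>
  proof (rule mono_bounded_tendsto_at_top[where a=2])
    fix x y :: real assume xy: "2 \<le> x" "x \<le> y"
    show "Q x \<le> Q y"
    proof (rule DERIV_nonneg_imp_nondecreasing[OF \<open>x \<le> y\<close>])
      fix z assume "x \<le> z"
      then show "\<exists>d. (Q has_real_derivative d) (at z) \<and> 0 \<le> d"
        using Q_deriv[of z] M_nonneg[of z] xy by (intro exI[of _ "M z / z\<^sup>2"]) simp
    qed
  next
    fix x :: real assume "2 \<le> x"
    then show "Q x \<le> C" using C by simp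
  qed
  then obtain q where q: "(Q \<longlongrightarrow> q) at_top" by blast
  \<comment> \<open>By \<open>E_le\<close> the derivative of \<open>F x / x\<^sup>2\<close> is at
    least \<open>- 2 * M x / x\<^sup>2\<close>; adding \<open>2 * Q x\<close> compensates for this
    and makes the sum monotone.\<close>
  have "\<exists>l. ((\<lambda>x. F x / x\<^sup>2 + 2 * Q x) \<longlongrightarrow> l) at_top"
  proof (rule mono_bounded_tendsto_at_top[where a=2])
    fix x y :: real assume xy: "2 \<le> x" "x \<le> y"
    show "F x / x\<^sup>2 + 2 * Q x \<le> F y / y\<^sup>2 + 2 * Q y"
    proof (rule DERIV_nonneg_imp_nondecreasing[OF \<open>x \<le> y\<close>])
      fix z assume "x \<le> z" "z \<le> y"
      then have z: "1 < z" using xy by simp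
      have "2 * E z \<le> S z * M z + 2 * (z * M z)"
        using E_le[of z] S_nonneg[of z] M_nonneg[of z] z by (simp add: add_increasing)
      then have "0 \<le> (S z * M z - 2 * E z + 2 * (z * M z)) / z ^ 3" using z by (intro divide_nonneg_nonneg) auto
      also have "\<dots> = (S z * M z - 2 * E z) / z ^ 3 + 2 * (M z / z\<^sup>2)"
        using z by (simp add: field_simps power2_eq_square power3_eq_cube)
      finally show "\<exists>d. ((\<lambda>x. F x / x\<^sup>2 + 2 * Q x) has_real_derivative d) (at z) \<and> 0 \<le> d"
        using DERIV_add[OF G_deriv[OF z] DERIV_cmult[OF Q_deriv[OF z], of 2]] by blast
    qed
  next
    fix x :: real assume "2 \<le> x"
    then show "F x / x\<^sup>2 + 2 * Q x \<le> 1 + 2 * C"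
      using F_le[of x] C[of x] by (intro add_mono) (auto simp: divide_le_eq)
  qed
  then obtain l where "((\<lambda>x. F x / x\<^sup>2 + 2 * Q x) \<longlongrightarrow> l) at_top" by blast
  from tendsto_diff[OF this tendsto_mult_left[OF q, of 2]] show ?thesis by auto
qed

text \<open>The correction by \<open>N x / x ^ 3\<close> trades the term \<open>- 2 * E x / x ^ 3\<close> in the derivative of
  \<open>F x / x\<^sup>2\<close> for \<open>- 6 * N x / x ^ 4\<close>, which is at least \<open>- 6 * M x / x\<^sup>2 * J x\<close>.
  Hence \<open>J x * exp (6 * Q x)\<close> is nondecreasing.\<close>

definition J where "J x = F x / x\<^sup>2 + 2 * (N x / x ^ 3)"

lemma J_lower_bound: "\<exists>c>0. \<forall>x\<ge>2. c \<le> J x"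
proof -
  obtain C where C: "\<And>x. x \<ge> 1 \<Longrightarrow> Q x \<le> C" using Q_bounded by blast
  have J_nonneg: "0 \<le> J x" if "0 \<le> x" for x
    unfolding J_def using F_nonneg N_nonneg that by (intro add_nonneg_nonneg) auto
  have mono: "J 2 * exp (6 * Q 2) \<le> J x * exp (6 * Q x)" if x: "2 \<le> x" for x
  proof (rule DERIV_nonneg_imp_nondecreasing[OF x])
    fix z :: real assume "2 \<le> z" "z \<le> x"
    then have z: "1 < z" by simp
    let ?J' = "(S z * M z - 2 * E z) / z ^ 3 + 2 * (E z / z ^ 3 - 3 * N z / z ^ 4)"
    have "((\<lambda>x. N x / x ^ 3) has_real_derivative E z / z ^ 3 - 3 * N z / z ^ 4) (at z)"
      using z by (auto intro!: derivative_eq_intros N_deriv simp: field_simps power2_eq_square power3_eq_cube power4_eq_xxxx)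
    then have J': "(J has_real_derivative ?J') (at z)"
      unfolding J_def using G_deriv[OF z] by (intro DERIV_add DERIV_cmult)
    have "((\<lambda>x. J x * exp (6 * Q x)) has_real_derivative
       (?J' + 6 * (M z / z\<^sup>2) * J z) * exp (6 * Q z)) (at z)"
      using Q_deriv[OF z] J' by (auto intro!: derivative_eq_intros simp: algebra_simps)
    moreover have "0 \<le> ?J' + 6 * (M z / z\<^sup>2) * J z"
    proof -
      \<comment> \<open>The grouping isolates \<open>M z * F z - N z\<close>, nonnegative by
        \<open>N_le\<close>; the other two summands are built from nonnegative factors.\<close>
      have "?J' + 6 * (M z / z\<^sup>2) * J z = S z * M z / z ^ 3 + 6 * ((M z * F z - N z) / z ^ 4)
          + 12 * (M z * N z / z ^ 5)"
        using z unfolding J_def by (simp add: field_simps eval_nat_numeral)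
      moreover have "0 \<le> S z * M z / z ^ 3" "0 \<le> (M z * F z - N z) / z ^ 4" "0 \<le> M z * N z / z ^ 5"
        using z N_le[of z] S_nonneg[of z] M_nonneg[of z] N_nonneg[of z] by auto
      ultimately show ?thesis by linarith
    qed
    then have "0 \<le> (?J' + 6 * (M z / z\<^sup>2) * J z) * exp (6 * Q z)"
      by (rule mult_nonneg_nonneg) simp
    ultimately show "\<exists>d. ((\<lambda>x. J x * exp (6 * Q x)) has_real_derivative d) (at z) \<and> 0 \<le> d"
      by blast
  qed
  \<comment> \<open>\<open>F 2 \<ge> F 1 = 1 / 2\<close> makes the starting value of the monotone
    function positive.\<close>
  have "0 < F 2" using F_mono[of 1 2] F_1 by simp
  then have "0 < J 2" unfolding J_def using N_nonneg[of 2] by (intro add_pos_nonneg) auto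
  show ?thesis
  proof (intro exI conjI allI impI)
    show "0 < J 2 * exp (6 * Q 2) * exp (- (6 * C))" using \<open>0 < J 2\<close> by simp
    fix x :: real assume x: "2 \<le> x"
    \<comment> \<open>As \<open>J x\<close> is nonnegative, the exponent may be raised to
      \<open>6 * C\<close>, which no longer depends on \<open>x\<close>.\<close>
    have "J 2 * exp (6 * Q 2) \<le> J x * exp (6 * C)"
      using mono[OF x] J_nonneg[of x] C[of x] x
      by (elim order_trans) (intro mult_left_mono, auto)
    then show "J 2 * exp (6 * Q 2) * exp (- (6 * C)) \<le> J x"
      by (simp add: exp_minus field_simps)
  qed
qed

theorem S_asymptotically_linear: "\<exists>\<alpha>>0. ((\<lambda>x. S x / x) \<longlongrightarrow> \<alpha>) at_top"
proof -
  obtain g where g: "((\<lambda>x. F x / x\<^sup>2) \<longlongrightarrow> g) at_top" using G_tendsto by blast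
  obtain c where c: "c > 0" "\<And>x. x \<ge> 2 \<Longrightarrow> c \<le> J x" using J_lower_bound by blast
  \<comment> \<open>\<open>M x / x\<close> dominates each of the three error terms below.\<close>
  have squeeze: "(f \<longlongrightarrow> 0) at_top"
    if "\<And>x. 1 < x \<Longrightarrow> 0 \<le> f x" "\<And>x. 1 < x \<Longrightarrow> f x \<le> M x / x" for f
    by (rule tendsto_sandwich[OF _ _ tendsto_const M_over_x_tendsto])
       (rule eventually_mono[OF eventually_gt_at_top[of 1]], erule that)+
  have N0: "((\<lambda>x. N x / x ^ 3) \<longlongrightarrow> 0) at_top"
  proof (rule squeeze)
    fix x :: real assume x: "1 < x"
    then show "0 \<le> N x / x ^ 3" using N_nonneg[of x] by auto
    have "N x \<le> M x * x\<^sup>2"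
      using N_le[of x] F_le[of x] M_nonneg[of x] x mult_left_mono[of "F x" "x\<^sup>2" "M x"] by simp
    then show "N x / x ^ 3 \<le> M x / x" using x by (simp add: field_simps eval_nat_numeral)
  qed
  have E0: "((\<lambda>x. E x / x\<^sup>2) \<longlongrightarrow> 0) at_top"
  proof (rule squeeze)
    fix x :: real assume x: "1 < x"
    then show "0 \<le> E x / x\<^sup>2" using E_nonneg[of x] by auto
    show "E x / x\<^sup>2 \<le> M x / x" using x E_le[of x] by (simp add: field_simps eval_nat_numeral)
  qed
  have SM0: "((\<lambda>x. S x * M x / x\<^sup>2) \<longlongrightarrow> 0) at_top"
  proof (rule squeeze)
    fix x :: real assume x: "1 < x"
    then show "0 \<le> S x * M x / x\<^sup>2" using S_nonneg[of x] M_nonneg[of x] by auto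
    have "S x * M x \<le> x * M x" using S_le[of x] M_nonneg[of x] x by (intro mult_right_mono) auto
    then show "S x * M x / x\<^sup>2 \<le> M x / x" using x by (simp add: field_simps eval_nat_numeral)
  qed
  \<comment> \<open>The correction by \<open>N\<close> vanishes in the limit, so \<open>J\<close>
    also tends to \<open>g\<close> and passes its positive lower bound on to it.\<close>
  have "(J \<longlongrightarrow> g + 2 * 0) at_top"
    unfolding J_def by (intro tendsto_intros g N0)
  then have "c \<le> g"
    by (intro tendsto_lowerbound[of J g at_top] eventually_mono[OF eventually_ge_at_top[of 2] c(2)]) auto
  then have "2 * g > 0" using c by simp
  \<comment> \<open>The expression is the right-hand side of \<open>S_eq\<close> divided by
    \<open>x\<^sup>2\<close>.\<close>
  moreover have "((\<lambda>x. 2 * (F x / x\<^sup>2) - 2 * (E x / x\<^sup>2) + S x * M x / x\<^sup>2) \<longlongrightarrow> 2 * g - 2 * 0 + 0) at_top"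
    by (intro tendsto_intros g E0 SM0)
  moreover have "\<forall>\<^sub>F x in at_top. 2 * (F x / x\<^sup>2) - 2 * (E x / x\<^sup>2) + S x * M x / x\<^sup>2 = S x / x"
    using eventually_gt_at_top[of 1]
  proof eventually_elim
    case (elim x)
    have "2 * (F x / x\<^sup>2) - 2 * (E x / x\<^sup>2) + S x * M x / x\<^sup>2 = (x * S x) / x\<^sup>2"
      unfolding S_eq[OF elim] by (simp add: add_divide_distrib diff_divide_distrib)
    also have "\<dots> = S x / x" using elim by (simp add: power2_eq_square)
    finally show ?case .
  qed
  ultimately show ?thesis using tendsto_cong by fastforce
qed

end

subsection \<open>Convergent length distributions\<close>

lemma norm_const_tendsto:
  assumes "(LINT l:{1..}|lebesgue. \<nu> l) = 1" "ldf \<nu>"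
  shows "(norm_const \<nu> \<longlongrightarrow> 1) at_top"
proof -
  \<comment> \<open>A function that is not integrable has integral 0 by convention, so the value 1
    forces integrability.\<close>
  have "set_integrable lebesgue {1..} \<nu>"
    using assms(1) not_integrable_integral_eq unfolding set_integrable_def set_lebesgue_integral_def by fastforce
  then have "((\<lambda>x. LINT l:{1..x}|lebesgue. \<nu> l) \<longlongrightarrow> (LINT l:{1..}|lebesgue. \<nu> l)) at_top"
    by (rule tendsto_set_lebesgue_integral_at_top[rotated]) auto
  moreover have "norm_const \<nu> = (\<lambda>x. LINT l:{1..x}|lebesgue. \<nu> l)"
    by (rule ext) (rule norm_const_eq[OF assms(2)])
  ultimately show ?thesis using assms(1) by simp
qed

lemma continuous_on_norm_const:
  assumes ldf: "ldf \<nu>"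
  shows "continuous_on UNIV (norm_const \<nu>)"
proof (rule continuous_at_imp_continuous_on, rule ballI)
  fix x :: real
  have int: "set_integrable lebesgue {0..b} \<nu>" for b using ldf by (simp add: ldf_def)
  have eq: "norm_const \<nu> y = integral {0..y} \<nu>" for y
    using set_lebesgue_integral_eq_integral(2)[OF int] by (simp add: norm_const_def)
  have *: "continuous_on {0..x + 1} (norm_const \<nu>)"
    unfolding eq by (rule indefinite_integral_continuous_1[OF set_lebesgue_integral_eq_integral(1)[OF int]])
  show "isCont (norm_const \<nu>) x"
  proof (cases "0 < x")
    case True
    then show ?thesis using continuous_on_interior[OF *, of x] by simp
  next
    case False
    have "\<forall>\<^sub>F y in nhds x. norm_const \<nu> y = 0"
      using eventually_nhds_in_open[of "{..<1}" x, OF open_lessThan] False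
      by (auto elim!: eventually_mono simp: norm_const_eq_0[OF ldf])
    then show ?thesis using isCont_cong[of "norm_const \<nu>" "\<lambda>_. 0" x] by simp
  qed
qed

lemma gap_integral_eq_integral:
  fixes g :: "real \<Rightarrow> real"
  assumes ldf: "ldf \<nu>" and "\<And>t. t \<in> {0..x} \<Longrightarrow> 0 \<le> g t"
    and "(\<lambda>t. g t * norm_const \<nu> (x - t)) integrable_on {0..x}"
  shows "gap_integral \<nu> (\<lambda>t. ennreal (g t)) x = ennreal (integral {0..x} (\<lambda>t. g t * norm_const \<nu> (x - t)))"
proof -
  have "gap_integral \<nu> (\<lambda>t. ennreal (g t)) x =
      (\<integral>\<^sup>+t. ennreal (g t * norm_const \<nu> (x - t)) * indicator {0..x} t \<partial>lborel)"
    unfolding gap_integral_def using assms(2) norm_const_nonneg[OF ldf]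
    by (intro nn_integral_cong) (auto simp: indicator_def ennreal_mult)
  also have "\<dots> = ennreal (integral {0..x} (\<lambda>t. g t * norm_const \<nu> (x - t)))"
    by (rule nn_integral_has_integral_lebesgue'[OF _ integrable_integral[OF assms(3)]])
       (use assms(2) norm_const_nonneg[OF ldf] in auto)
  finally show ?thesis .
qed

lemma expected_empty_space_integral_equation:
  assumes ldf: "ldf \<nu>" and x: "1 < x"
  shows "expected_empty_space \<nu> x * integral {0..x} (norm_const \<nu>) =
    2 * integral {0..x} (\<lambda>t. expected_empty_space \<nu> t * norm_const \<nu> (x - t))"
proof -
  let ?S = "expected_empty_space \<nu>" and ?Z = "norm_const \<nu>"
  have S: "0 \<le> ?S t" "?S t \<le> t" if "0 \<le> t" for t
    using expected_empty_space_bounds[OF ldf that] by auto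
  have cont: "continuous_on A (\<lambda>t. ?Z (x - t))" for A
    by (intro continuous_on_compose2[OF continuous_on_norm_const[OF ldf]] continuous_intros) auto
  \<comment> \<open>The factor 1 presents the coefficient of the recursion as the gap integral of a
    constant.\<close>
  have int1: "(\<lambda>t. 1 * ?Z (x - t)) integrable_on {0..x}"
    using integrable_continuous_real[OF cont] by simp
  have "?S t * ?Z (x - t) \<le> x * ?Z x" "0 \<le> ?S t * ?Z (x - t)" if "t \<in> {0..x}" for t
    using that S[of t] norm_const_nonneg[OF ldf] monoD[OF norm_const_mono[OF ldf], of "x - t" x]
    by (auto intro!: mult_mono)
  then have int2: "(\<lambda>t. ?S t * ?Z (x - t)) integrable_on {0..x}"
    using borel_measurable_expected_empty_space[OF ldf] borel_measurable_norm_const[OF ldf]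
    by (intro bounded_measurable_integrable_on[where B="x * ?Z x"]) auto
  have pos: "0 \<le> integral {0..x} (\<lambda>t. ?S t * ?Z (x - t))" "0 \<le> integral {0..x} (\<lambda>t. ?Z (x - t))"
    using integral_nonneg[OF int2] integral_nonneg[OF int1] S norm_const_nonneg[OF ldf] by auto
  have "ennreal (?S x) * ennreal (integral {0..x} (\<lambda>t. ?Z (x - t))) =
      2 * ennreal (integral {0..x} (\<lambda>t. ?S t * ?Z (x - t)))"
    using expected_empty_space_recursion[OF assms]
      gap_integral_eq_integral[OF ldf _ int1] gap_integral_eq_integral[OF ldf _ int2] S by simp
  then have "ennreal (?S x * integral {0..x} (\<lambda>t. ?Z (x - t))) =
      ennreal (2 * integral {0..x} (\<lambda>t. ?S t * ?Z (x - t)))"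
    using S[of x] x pos by (simp add: ennreal_mult)
  then have "?S x * integral {0..x} (\<lambda>t. ?Z (x - t)) = 2 * integral {0..x} (\<lambda>t. ?S t * ?Z (x - t))"
    using S[of x] x pos by (subst (asm) ennreal_inj) auto
  then show ?thesis by (simp add: integral_reflect_Icc)
qed

lemma tail_integral_bounded:
  assumes ldf: "ldf \<nu>" and le_1: "\<And>x. norm_const \<nu> x \<le> 1"
    and fin: "(\<integral>\<^sup>+L\<in>{1..}. ennreal ((1 - norm_const \<nu> L) / L) \<partial>lebesgue) < \<infinity>"
  shows "\<exists>C. \<forall>x\<ge>1. integral {1..x} (\<lambda>t. (1 - norm_const \<nu> t) / t) \<le> C"
proof -
  let ?r = "\<lambda>t. (1 - norm_const \<nu> t) / t"
  note borel_measurable_norm_const[OF ldf, measurable]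
  have bd: "ennreal (integral {1..x} ?r) \<le> (\<integral>\<^sup>+L\<in>{1..}. ennreal (?r L) \<partial>lebesgue)" for x
  proof -
    have "?r integrable_on {1..x}"
      by (intro integrable_continuous_real continuous_intros continuous_on_subset[OF continuous_on_norm_const[OF ldf]]) auto
    then have "ennreal (integral {1..x} ?r) = (\<integral>\<^sup>+L. ennreal (?r L) * indicator {1..x} L \<partial>lborel)"
      by (intro nn_integral_has_integral_lebesgue'[symmetric] integrable_integral) (auto simp: le_1)
    also have "\<dots> \<le> (\<integral>\<^sup>+L. ennreal (?r L) * indicator {1..} L \<partial>lborel)"
      by (intro nn_integral_mono) (auto simp: indicator_def)
    also have "\<dots> = (\<integral>\<^sup>+L\<in>{1..}. ennreal (?r L) \<partial>lebesgue)"
      by (subst nn_integral_completion) auto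
    finally show ?thesis .
  qed
  then have "integral {1..x} ?r \<le> enn2real (\<integral>\<^sup>+L\<in>{1..}. ennreal (?r L) \<partial>lebesgue)" for x
  proof -
    have "ennreal (integral {1..x} ?r) \<le> ennreal (enn2real (\<integral>\<^sup>+L\<in>{1..}. ennreal (?r L) \<partial>lebesgue))"
      using bd[of x] fin by simp
    then show ?thesis by (subst (asm) ennreal_le_iff) auto
  qed
  then show ?thesis by blast
qed

theorem theorem5p3:
  fixes \<nu> :: "real \<Rightarrow> real"
  assumes "convergent_ldf \<nu>"
    and "(LINT l:{1..}|lebesgue. \<nu> l) = 1"
    and "(\<integral>\<^sup>+L\<in>{1..}. ennreal ((1 - norm_const \<nu> L) / L) \<partial>lebesgue) < \<infinity>"
  shows "\<exists>\<alpha>>0. ((\<lambda>L. expected_empty_space \<nu> L / (\<alpha> * L)) \<longlongrightarrow> 1) at_top"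
proof -
  have ldf: "ldf \<nu>" using assms(1) by (simp add: convergent_ldf_def)
  have lim: "(norm_const \<nu> \<longlongrightarrow> 1) at_top" by (rule norm_const_tendsto[OF assms(2) ldf])
  have le_1: "norm_const \<nu> x \<le> 1" for x
    using eventually_mono[OF eventually_ge_at_top[of x] monoD[OF norm_const_mono[OF ldf]]]
    by (intro tendsto_lowerbound[OF lim]) auto
  \<comment> \<open>From here on the process enters only through its integral equation, elementary
    bounds and the tail condition.\<close>
  interpret gap_equation "norm_const \<nu>" "expected_empty_space \<nu>"
    by unfold_locales
      (use ldf lim tail_integral_bounded[OF ldf le_1 assms(3)] in
        \<open>simp_all add: continuous_on_norm_const norm_const_mono norm_const_eq_0 norm_const_pos
          borel_measurable_expected_empty_space expected_empty_space_bounds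
          expected_empty_space_integral_equation expected_empty_space_le_1\<close>)
  obtain \<alpha> where \<alpha>: "\<alpha> > 0" "((\<lambda>x. expected_empty_space \<nu> x / x) \<longlongrightarrow> \<alpha>) at_top"
    using S_asymptotically_linear by blast
  then have "((\<lambda>x. expected_empty_space \<nu> x / x / \<alpha>) \<longlongrightarrow> \<alpha> / \<alpha>) at_top"
    by (intro tendsto_intros) auto
  with \<alpha>(1) show ?thesis by (auto simp: mult.commute)
qed

end
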